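(* Let $X\subset\mathbb{R}^d$ be a set of $n$ points and $k,z\in\mathbb{N}$ with $z\ge1$. Let $p=\max\left(\frac{36}{z}\log\frac{4nk^2}{z},\ \frac{36k}{z}\log(2k^3)\right)$ and let $Y$ (with weights $w$) be the output of $\textsc{SampleCoreset}(X,k,z)$. Then with constant probability, the weighted instance $(Y,k,z')$, where $z'=z$ if $p>1$ and $z'=2.5pz$ if $p\le 1$, is an $(O(1),O(1))$-coreset for the $k$-means with outliers instance $(X,k,z)$, and $|Y|=O(k\log n)$ in expectation.
   Context: Distances are Euclidean. For a (multi)set $P$ of points with positive integer weights (interpreted as multiplicities), $k$ centers $C$ and $z\ge0$, $P_z(C)$ is the multiset obtained by discarding the $z$ copies with largest $d(x,C)$, $f^P_z(C)=\sum_{x\in P_z(C)}d^2(x,C)$, and $Opt(P,k,z)=\min_C f^P_z(C)$ over sets $C$ of $k$ points of $\mathbb{R}^d$. An instance $(Y,k,z')$ is an $(\alpha,\beta)$-coreset for $(X,k,z)$ if for every set $C$ of $k$ centers and every $\kappa_1,\kappa_2>0$ with $f^Y_{\kappa_1 z'}(C)\le\kappa_2\,Opt(Y,k,z')$, we have $f^X_{\alpha\kappa_1 z}(C)\le\beta\kappa_2\,Opt(X,k,z)$. $\textsc{k-means++}(P,m)$ ($D^2$-sampling) picks $m$ points of $P$: the first uniformly at random, each subsequent one choosing $x\in P$ with probability proportional to $d^2(x,S)$ where $S$ is the set chosen so far; the output $Y=\{y_1,\dots,y_m\}$ is weighted by $w(y_i)=|Y_i|$, where $Y_1,\dots,Y_m$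 is the partition of $P$ assigning each point to its closest chosen point. Algorithm $\textsc{SampleCoreset}(X,k,z)$: if $p>1$, output $\textsc{k-means++}(X,32(k+z))$; otherwise let $S$ contain each $x\in X$ independently with probability $p$ and output $\textsc{k-means++}(S,32(k+2.5pz))$.
   Formalization: In the coreset definition the factors κ₁, κ₂ range over values ≥ 1 instead of > 0 (with arbitrarily small factors the claim fails for all constants); d, k, n ≥ 1 are assumed, and the size bound is stated for n ≥ 2. *)

theory Defs
  imports "HOL-Probability.Probability" "HOL-Probability.Product_PMF" "HOL-Library.Multiset"
begin

text \<open>
  Points of \<open>\<real>\<^sup>d\<close> are the elements of \<open>topspace (Euclidean_space d)\<close>, i.e. functions
  \<open>nat \<Rightarrow> real\<close> that vanish from index \<open>d\<close> on. The dimension is a natural number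
  and not a type, so that absolute constants can be quantified outside of it.
\<close>

type_synonym point = "nat \<Rightarrow> real"

definition edist :: "nat \<Rightarrow> point \<Rightarrow> point \<Rightarrow> real" where
  "edist d x y = L2_set (\<lambda>i. x i - y i) {..<d}"

definition dist_to :: "nat \<Rightarrow> point \<Rightarrow> point set \<Rightarrow> real" where
  "dist_to d x C = Min (edist d x ` C)"

definition centers :: "nat \<Rightarrow> nat \<Rightarrow> point set set" where
  "centers d k = {C. C \<subseteq> topspace (Euclidean_space d) \<and> finite C \<and> card C = k}"

text \<open>
  The choice only resolves ties. A real budget \<open>z\<close> allows \<open>\<lfloor>z\<rfloor>\<close> copies to be discarded
  (all of them if there are fewer).
\<close>

definition trimmed :: "nat \<Rightarrow> point multiset \<Rightarrow> real \<Rightarrow> point set \<Rightarrow> point multiset" where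
  "trimmed d P z C = (SOME Q. Q \<subseteq># P \<and> size Q = size P - nat \<lfloor>z\<rfloor> \<and>
      (\<forall>x\<in>#Q. \<forall>y\<in>#P - Q. dist_to d x C \<le> dist_to d y C))"

definition cost :: "nat \<Rightarrow> point multiset \<Rightarrow> real \<Rightarrow> point set \<Rightarrow> real" where
  "cost d P z C = (\<Sum>x\<in>#trimmed d P z C. (dist_to d x C)\<^sup>2)"

definition Opt :: "nat \<Rightarrow> point multiset \<Rightarrow> nat \<Rightarrow> real \<Rightarrow> real" where
  "Opt d P k z = (INF C\<in>centers d k. cost d P z C)"

text \<open>
  The factors \<open>\<kappa>\<^sub>1\<close>, \<open>\<kappa>\<^sub>2\<close> are bicriteria approximation factors and hence at least 1.
  If arbitrarily small factors were admitted, no absolute \<open>\<alpha>\<close>, \<open>\<beta>\<close> would do: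
  as \<open>\<kappa>\<^sub>1\<close> tends to 0, no copy of \<open>X\<close> may be discarded, although a sample misses far
  outliers of \<open>X\<close>; and if \<open>cost d Y (\<kappa>\<^sub>1 * z') C = 0\<close> (e.g. because \<open>C\<close> contains all but a
  few, light, points of \<open>Y\<close>), then letting \<open>\<kappa>\<^sub>2\<close> tend to 0 would force
  \<open>cost d X (\<alpha> * \<kappa>\<^sub>1 * z) C = 0\<close>.
\<close>

definition is_coreset ::
  "nat \<Rightarrow> nat \<Rightarrow> real \<Rightarrow> real \<Rightarrow> point multiset \<Rightarrow> real \<Rightarrow> point multiset \<Rightarrow> real \<Rightarrow> bool" where
  "is_coreset d k \<alpha> \<beta> Y z' X z \<longleftrightarrow>
     (\<forall>C\<in>centers d k. \<forall>\<kappa>\<^sub>1\<ge>1. \<forall>\<kappa>\<^sub>2\<ge>1.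
        cost d Y (\<kappa>\<^sub>1 * z') C \<le> \<kappa>\<^sub>2 * Opt d Y k z' \<longrightarrow>
        cost d X (\<alpha> * \<kappa>\<^sub>1 * z) C \<le> \<beta> * \<kappa>\<^sub>2 * Opt d X k z)"

definition weighted_mset :: "point set \<Rightarrow> (point \<Rightarrow> nat) \<Rightarrow> point multiset" where
  "weighted_mset Y w = (\<Sum>y\<in>Y. replicate_mset (w y) y)"

definition d2_next :: "nat \<Rightarrow> point set \<Rightarrow> point list \<Rightarrow> point pmf" where
  "d2_next d P ys =
     (if ys = [] then pmf_of_set P
      else embed_pmf (\<lambda>x. if x \<in> P
             then (dist_to d x (set ys))\<^sup>2 / (\<Sum>u\<in>P. (dist_to d u (set ys))\<^sup>2) else 0))"

text \<open>Sampling stops early once all of \<open>P\<close> has been chosen, as all \<open>D\<^sup>2\<close>-weights are then 0.\<close>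

primrec d2_sample :: "nat \<Rightarrow> point set \<Rightarrow> nat \<Rightarrow> point list pmf" where
  "d2_sample d P 0 = return_pmf []"
| "d2_sample d P (Suc m) =
     bind_pmf (d2_sample d P m)
       (\<lambda>ys. if P \<subseteq> set ys then return_pmf ys
             else map_pmf (\<lambda>y. ys @ [y]) (d2_next d P ys))"

text \<open>
  A rule \<open>\<tau>\<close> for choosing, for each point \<open>x\<close>, a closest point \<open>\<tau> ys x\<close> among the
  chosen points \<open>ys\<close>; it fixes how ties are broken in the partition.
\<close>

definition closest_rule :: "nat \<Rightarrow> (point list \<Rightarrow> point \<Rightarrow> point) \<Rightarrow> bool" where
  "closest_rule d \<tau> \<longleftrightarrow>
     (\<forall>ys x. ys \<noteq> [] \<and> set ys \<subseteq> topspace (Euclidean_space d) \<and> x \<in> topspace (Euclidean_space d) \<longrightarrow>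
        \<tau> ys x \<in> set ys \<and> edist d x (\<tau> ys x) = dist_to d x (set ys))"

definition kmeanspp ::
  "nat \<Rightarrow> (point list \<Rightarrow> point \<Rightarrow> point) \<Rightarrow> point set \<Rightarrow> nat \<Rightarrow> (point set \<times> (point \<Rightarrow> nat)) pmf" where
  "kmeanspp d \<tau> P m =
     map_pmf (\<lambda>ys. (set ys, \<lambda>y. card {x \<in> P. \<tau> ys x = y})) (d2_sample d P m)"

definition sample_prob :: "nat \<Rightarrow> nat \<Rightarrow> nat \<Rightarrow> real" where
  "sample_prob n k z =
     max (36 / real z * ln (4 * real n * (real k)\<^sup>2 / real z))
         (36 * real k / real z * ln (2 * real k ^ 3))"

definition subsample :: "point set \<Rightarrow> real \<Rightarrow> point set pmf" where
  "subsample X p = map_pmf (\<lambda>b. {x \<in> X. b x}) (Pi_pmf X False (\<lambda>_. bernoulli_pmf p))"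

definition sample_coreset ::
  "nat \<Rightarrow> (point list \<Rightarrow> point \<Rightarrow> point) \<Rightarrow> point set \<Rightarrow> nat \<Rightarrow> nat \<Rightarrow> (point set \<times> (point \<Rightarrow> nat)) pmf" where
  "sample_coreset d \<tau> X k z =
     (let p = sample_prob (card X) k z in
      if p > 1 then kmeanspp d \<tau> X (32 * (k + z))
      else bind_pmf (subsample X p)
             (\<lambda>S. kmeanspp d \<tau> S (nat \<lceil>32 * (real k + 2.5 * p * real z)\<rceil>)))"

end

theory Submission
  imports Defs
begin

text \<open>
  Write \<open>Opt\<close> for the optimum with \<open>k\<close> centres and \<open>z\<close> outliers. Giving every outlier its own
  centre shows that \<open>k + z\<close> centres suffice for cost \<open>O(Opt)\<close> without outliers. As long as the
  cost of the chosen points exceeds a large multiple of this, a \<open>D\<^sup>2\<close>-sample makes a further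
  reference cluster cheap with probability at least \<open>1/16\<close>; hence \<open>32 (k + z)\<close> samples bring
  the cost down to \<open>O(Opt)\<close> with constant probability. Moving every point to its closest chosen
  point then changes all costs by \<open>O(Opt)\<close> only, up to constant factors.

  For the preliminary uniform sample, fix one near-optimal solution. With constant probability
  its outliers and its cost are represented at most proportionally (Markov), and each of its
  clusters with at least \<open>z / k\<close> points is represented at least proportionally (an exponential
  moment bound), all up to constant factors. These finitely many events suffice for all centre
  sets simultaneously: the smaller clusters, and those of which the given centres discard half
  of the sample, contain \<open>O(z)\<close> points and may be discarded, while each point of another
  cluster is served via the average undiscarded sample point of its cluster.
\<close>

section \<open>Squared distances\<close>

definition sqdist :: "nat \<Rightarrow> point \<Rightarrow> point \<Rightarrow> real" where
  "sqdist d x y = (edist d x y)\<^sup>2"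

definition sqdist_to :: "nat \<Rightarrow> point \<Rightarrow> point set \<Rightarrow> real" where
  "sqdist_to d x C = (dist_to d x C)\<^sup>2"

definition sum_sqdist :: "nat \<Rightarrow> point set \<Rightarrow> point set \<Rightarrow> real" where
  "sum_sqdist d A C = (\<Sum>x\<in>A. sqdist_to d x C)"

definition nearest :: "nat \<Rightarrow> point set \<Rightarrow> point \<Rightarrow> point" where
  "nearest d C x = arg_min_on (edist d x) C"

lemma sqdist_eq_sum: "sqdist d x y = (\<Sum>i<d. (x i - y i)\<^sup>2)"
  by (simp add: sqdist_def edist_def L2_set_def sum_nonneg)

lemma edist_nonneg: "0 \<le> edist d x y"
  by (simp add: edist_def L2_set_nonneg)

lemma sqdist_nonneg [simp]: "0 \<le> sqdist d x y"
  by (simp add: sqdist_def)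

lemma sqdist_to_nonneg [simp]: "0 \<le> sqdist_to d x C"
  by (simp add: sqdist_to_def)

lemma sum_sqdist_nonneg [simp]: "0 \<le> sum_sqdist d A C"
  by (simp add: sum_sqdist_def sum_nonneg)

lemma sqdist_self [simp]: "sqdist d x x = 0"
  by (simp add: sqdist_eq_sum)

lemma sqdist_to_singleton [simp]: "sqdist_to d x {c} = sqdist d x c"
  by (simp add: sqdist_to_def sqdist_def dist_to_def)

lemma sqdist_commute: "sqdist d x y = sqdist d y x"
  by (simp add: sqdist_eq_sum power2_commute)

lemma sqdist_triangle: "sqdist d x z \<le> 2 * sqdist d x y + 2 * sqdist d y z"
proof -
  have "(x i - z i)\<^sup>2 \<le> 2 * (x i - y i)\<^sup>2 + 2 * (y i - z i)\<^sup>2" for i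
    using zero_le_power2[of "(x i - y i) - (y i - z i)"]
    by (simp add: power2_eq_square algebra_simps)
  then show ?thesis
    unfolding sqdist_eq_sum sum_distrib_left sum.distrib[symmetric] by (intro sum_mono)
qed

lemma sqdist_eq_0_iff:
  assumes "x \<in> topspace (Euclidean_space d)" "y \<in> topspace (Euclidean_space d)"
  shows "sqdist d x y = 0 \<longleftrightarrow> x = y"
proof
  assume "sqdist d x y = 0"
  then have "x i = y i" if "i < d" for i
    using that by (simp add: sqdist_eq_sum sum_nonneg_eq_0_iff)
  then have "x i = y i" for i
    using assms by (cases "i < d") (auto simp: topspace_Euclidean_space)
  then show "x = y" ..
qed simp

lemma nearest:
  assumes "finite C" "C \<noteq> {}"
  shows nearest_in: "nearest d C x \<in> C"
    and dist_to_eq_nearest: "dist_to d x C = edist d x (nearest d C x)"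
    and sqdist_to_eq_nearest: "sqdist_to d x C = sqdist d x (nearest d C x)"
proof -
  show mem: "nearest d C x \<in> C"
    unfolding nearest_def by (rule arg_min_if_finite(1)[OF assms])
  show "dist_to d x C = edist d x (nearest d C x)"
    unfolding dist_to_def using assms mem
    by (intro Min_eqI) (auto simp: nearest_def intro: arg_min_least[OF assms])
  then show "sqdist_to d x C = sqdist d x (nearest d C x)"
    by (simp add: sqdist_to_def sqdist_def)
qed

lemma dist_to_nonneg: "\<lbrakk>finite C; C \<noteq> {}\<rbrakk> \<Longrightarrow> 0 \<le> dist_to d x C"
  by (simp add: dist_to_eq_nearest edist_nonneg)

lemma sqdist_to_le:
  assumes "finite C" "c \<in> C"
  shows "sqdist_to d x C \<le> sqdist d x c"
proof -
  have "C \<noteq> {}"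
    using assms(2) by auto
  then have "0 \<le> dist_to d x C"
    by (rule dist_to_nonneg[OF assms(1)])
  then show ?thesis
    unfolding sqdist_to_def sqdist_def using assms by (intro power_mono) (auto simp: dist_to_def)
qed

lemma sqdist_to_antimono:
  assumes "finite C" "B \<subseteq> C" "B \<noteq> {}"
  shows "sqdist_to d x C \<le> sqdist_to d x B"
proof -
  have "finite B"
    using assms finite_subset by blast
  then show ?thesis
    using assms nearest_in[of B d x] by (auto simp: sqdist_to_eq_nearest[of B] intro!: sqdist_to_le)
qed

lemma sqdist_to_triangle:
  assumes "finite C" "C \<noteq> {}"
  shows "sqdist_to d x C \<le> 2 * sqdist d x y + 2 * sqdist_to d y C"
proof -
  have "sqdist_to d x C \<le> sqdist d x (nearest d C y)"
    using assms by (intro sqdist_to_le nearest_in)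
  also have "\<dots> \<le> 2 * sqdist d x y + 2 * sqdist_to d y C"
    unfolding sqdist_to_eq_nearest[OF assms] by (rule sqdist_triangle)
  finally show ?thesis .
qed

lemma sqdist_to_relay:
  assumes "finite C" "C \<noteq> {}"
  shows "sqdist_to d x C \<le> 4 * sqdist d x c + 4 * sqdist d s c + 2 * sqdist_to d s C"
  using sqdist_to_triangle[OF assms, of d x s] sqdist_triangle[of d x s c]
  by (simp add: sqdist_commute)

lemma sqdist_to_image_nearest_le:
  assumes fin_V: "finite V" "x \<in> V" and fin_D: "finite D" "D \<noteq> {}"
  shows "sqdist_to d x (nearest d V ` D) \<le> 4 * sqdist_to d x D"
proof -
  define c where "c = nearest d D x"
  have "c \<in> D" and dist_c: "sqdist_to d x D = sqdist d x c"
    unfolding c_def using fin_D by (simp_all add: nearest_in sqdist_to_eq_nearest)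
  have "V \<noteq> {}"
    using fin_V(2) by auto
  have "sqdist_to d x (nearest d V ` D) \<le> sqdist d x (nearest d V c)"
    using fin_D(1) \<open>c \<in> D\<close> by (intro sqdist_to_le) auto
  also have "\<dots> \<le> 2 * sqdist d x c + 2 * sqdist d c (nearest d V c)"
    by (rule sqdist_triangle)
  also have "sqdist d c (nearest d V c) = sqdist_to d c V"
    by (simp add: sqdist_to_eq_nearest fin_V(1) \<open>V \<noteq> {}\<close>)
  also have "\<dots> \<le> sqdist d x c"
    using sqdist_to_le[OF fin_V] by (simp add: sqdist_commute)
  finally show ?thesis
    using dist_c by simp
qed

lemma sqdist_to_eq_0: "\<lbrakk>finite C; x \<in> C\<rbrakk> \<Longrightarrow> sqdist_to d x C = 0"
  using sqdist_to_le[of C x d x] by (simp add: order_antisym)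

lemma sqdist_to_pos:
  assumes "finite C" "C \<noteq> {}" "C \<subseteq> topspace (Euclidean_space d)"
    and "x \<in> topspace (Euclidean_space d)" "x \<notin> C"
  shows "0 < sqdist_to d x C"
proof -
  have "nearest d C x \<in> C"
    using assms by (intro nearest_in)
  then have "sqdist d x (nearest d C x) \<noteq> 0"
    using assms by (subst sqdist_eq_0_iff) auto
  then show ?thesis
    using assms by (simp add: sqdist_to_eq_nearest less_le)
qed

lemma sum_sqdist_antimono:
  "\<lbrakk>finite C; B \<subseteq> C; B \<noteq> {}\<rbrakk> \<Longrightarrow> sum_sqdist d A C \<le> sum_sqdist d A B"
  unfolding sum_sqdist_def by (intro sum_mono sqdist_to_antimono)

lemma sum_sqdist_mono: "\<lbrakk>finite B; A \<subseteq> B\<rbrakk> \<Longrightarrow> sum_sqdist d A C \<le> sum_sqdist d B C"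
  unfolding sum_sqdist_def by (intro sum_mono2) auto

lemma sum_sqdist_eq_0: "\<lbrakk>finite C; A \<subseteq> C\<rbrakk> \<Longrightarrow> sum_sqdist d A C = 0"
  unfolding sum_sqdist_def by (intro sum.neutral) (auto intro: sqdist_to_eq_0)

section \<open>Trimmed costs\<close>

lemma exists_smallest_submset:
  fixes f :: "'a \<Rightarrow> 'b::linorder"
  assumes "n \<le> size P"
  shows "\<exists>Q. Q \<subseteq># P \<and> size Q = n \<and> (\<forall>x\<in>#Q. \<forall>y\<in>#P - Q. f x \<le> f y)"
proof -
  obtain xs where "mset xs = P"
    using ex_mset by blast
  define ys where "ys = sort_key f xs"
  define Q where "Q = mset (take n ys)"
  have P_split: "P = Q + mset (drop n ys)"
    using \<open>mset xs = P\<close> by (simp add: Q_def ys_def flip: mset_append)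
  have "sorted (map f (take n ys) @ map f (drop n ys))"
    by (simp add: ys_def flip: map_append)
  then have "\<forall>x\<in>#Q. \<forall>y\<in>#P - Q. f x \<le> f y"
    by (simp add: sorted_append P_split Q_def)
  moreover have "size Q = n"
    using assms \<open>mset xs = P\<close> by (auto simp: Q_def ys_def)
  moreover have "Q \<subseteq># P"
    by (simp add: P_split)
  ultimately show ?thesis
    by blast
qed

lemma sum_mset_le_if_dominated:
  fixes f :: "'a \<Rightarrow> 'b::ordered_comm_monoid_add"
  assumes "size A \<le> size B" "\<And>x y. \<lbrakk>x \<in># A; y \<in># B\<rbrakk> \<Longrightarrow> f x \<le> f y" "\<And>y. y \<in># B \<Longrightarrow> 0 \<le> f y"
  shows "(\<Sum>x\<in>#A. f x) \<le> (\<Sum>y\<in>#B. f y)"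
  using assms
proof (induction A arbitrary: B)
  case empty
  then show ?case
    using sum_mset_mono[of B "\<lambda>_. 0" f] by simp
next
  case (add x A)
  then obtain y B' where B_eq: "B = add_mset y B'"
    by (cases B) auto
  then show ?case
    using add by (auto intro!: add_mono)
qed

lemma sum_mset_smallest_le:
  fixes f :: "'a \<Rightarrow> 'b::ordered_comm_monoid_add"
  assumes "T \<subseteq># P" "Q \<subseteq># P" "size T \<le> size Q"
    and smallest: "\<And>x y. \<lbrakk>x \<in># T; y \<in># P - T\<rbrakk> \<Longrightarrow> f x \<le> f y" and nonneg: "\<And>x. 0 \<le> f x"
  shows "(\<Sum>x\<in>#T. f x) \<le> (\<Sum>x\<in>#Q. f x)"
proof -
  have T_split: "T = (T \<inter># Q) + (T - Q)" and Q_split: "Q = (T \<inter># Q) + (Q - T)"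
    by (auto simp: multiset_eq_iff)
  have diff_subset: "Q - T \<subseteq># P - T"
    using assms(2) by (auto simp: subseteq_mset_def diff_le_mono)
  have "size (T - Q) \<le> size (Q - T)"
    using assms(3) T_split Q_split by (metis add_le_cancel_left size_union)
  then have "(\<Sum>x\<in>#T - Q. f x) \<le> (\<Sum>x\<in>#Q - T. f x)"
    using smallest nonneg mset_subset_eqD[OF diff_subset]
    by (intro sum_mset_le_if_dominated) (auto dest: in_diffD)
  then show ?thesis
    by (subst T_split, subst Q_split) (simp add: add_left_mono)
qed

lemma sum_mset_nonneg:
  fixes f :: "'a \<Rightarrow> 'b::ordered_comm_monoid_add"
  shows "(\<And>x. 0 \<le> f x) \<Longrightarrow> 0 \<le> (\<Sum>x\<in>#A. f x)"
  using sum_mset_mono[of A "\<lambda>_. 0" f] by simp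

lemma trimmed:
  shows trimmed_subset: "trimmed d P z C \<subseteq># P"
    and size_trimmed: "size (trimmed d P z C) = size P - nat \<lfloor>z\<rfloor>"
    and dist_to_trimmed_le:
      "\<lbrakk>x \<in># trimmed d P z C; y \<in># P - trimmed d P z C\<rbrakk> \<Longrightarrow> dist_to d x C \<le> dist_to d y C"
proof -
  have "\<exists>Q. Q \<subseteq># P \<and> size Q = size P - nat \<lfloor>z\<rfloor> \<and>
      (\<forall>x\<in>#Q. \<forall>y\<in>#P - Q. dist_to d x C \<le> dist_to d y C)"
    by (rule exists_smallest_submset) simp
  from someI_ex[OF this] show "trimmed d P z C \<subseteq># P"
    "size (trimmed d P z C) = size P - nat \<lfloor>z\<rfloor>"
    "\<lbrakk>x \<in># trimmed d P z C; y \<in># P - trimmed d P z C\<rbrakk> \<Longrightarrow> dist_to d x C \<le> dist_to d y C"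
    unfolding trimmed_def by blast+
qed

lemma cost_eq: "cost d P z C = (\<Sum>x\<in>#trimmed d P z C. sqdist_to d x C)"
  by (simp add: cost_def sqdist_to_def)

lemma cost_nonneg [simp]: "0 \<le> cost d P z C"
  by (simp add: cost_eq sum_mset_nonneg)

lemma cost_attained:
  assumes "0 \<le> z"
  obtains Q where "Q \<subseteq># P" "real (size (P - Q)) \<le> z" "cost d P z C = (\<Sum>x\<in>#Q. sqdist_to d x C)"
proof -
  have "real (size (P - trimmed d P z C)) \<le> real (nat \<lfloor>z\<rfloor>)"
    by (simp add: size_Diff_submset trimmed_subset size_trimmed)
  also have "\<dots> \<le> z"
    using assms by linarith
  finally show ?thesis
    using that[OF trimmed_subset] cost_eq by blast
qed

lemma cost_le:
  assumes "finite C" "C \<noteq> {}" "Q \<subseteq># P" "real (size (P - Q)) \<le> z"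
  shows "cost d P z C \<le> (\<Sum>x\<in>#Q. sqdist_to d x C)"
  unfolding cost_eq
proof (rule sum_mset_smallest_le[OF trimmed_subset assms(3)])
  have "size (P - Q) \<le> nat \<lfloor>z\<rfloor>"
    using assms(4) by linarith
  then show "size (trimmed d P z C) \<le> size Q"
    using assms(3) by (simp add: size_trimmed size_Diff_submset)
  fix x y assume "x \<in># trimmed d P z C" "y \<in># P - trimmed d P z C"
  then show "sqdist_to d x C \<le> sqdist_to d y C"
    unfolding sqdist_to_def using assms(1,2) by (intro power_mono dist_to_trimmed_le dist_to_nonneg)
qed simp

lemma cost_antimono:
  assumes "finite C" "C \<noteq> {}" "0 \<le> z" "z \<le> z'"
  shows "cost d P z' C \<le> cost d P z C"
proof -
  obtain Q where "Q \<subseteq># P" "real (size (P - Q)) \<le> z" "cost d P z C = (\<Sum>x\<in>#Q. sqdist_to d x C)"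
    using cost_attained assms(3) by blast
  then show ?thesis
    using cost_le[of C Q P z'] assms by simp
qed

lemma submset_mset_setE:
  assumes "Q \<subseteq># mset_set X" "finite X"
  obtains R where "R \<subseteq> X" "Q = mset_set R"
proof
  show "set_mset Q \<subseteq> X"
    using assms by (metis set_mset_mono finite_set_mset_mset_set)
  show "Q = mset_set (set_mset Q)"
  proof (rule multiset_eqI)
    fix x
    have "count Q x \<le> 1"
      using mset_subset_eq_count[OF assms(1), of x] by (simp add: count_mset_set' split: if_splits)
    then show "count Q x = count (mset_set (set_mset Q)) x"
      by (cases "count Q x") (auto simp: count_mset_set' simp flip: count_greater_zero_iff)
  qed
qed

lemma cost_mset_set_attained:
  assumes "finite X" "0 \<le> z"
  obtains Q where "Q \<subseteq> X" "real (card (X - Q)) \<le> z" "cost d (mset_set X) z C = sum_sqdist d Q C"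
proof -
  obtain Q where Q_attains: "Q \<subseteq># mset_set X" "real (size (mset_set X - Q)) \<le> z"
    "cost d (mset_set X) z C = (\<Sum>x\<in>#Q. sqdist_to d x C)"
    using cost_attained assms(2) by blast
  obtain R where "R \<subseteq> X" "Q = mset_set R"
    using submset_mset_setE[OF Q_attains(1) assms(1)] .
  with Q_attains(2,3) that[of R] assms(1) show ?thesis
    by (simp add: sum_sqdist_def sum_unfold_sum_mset flip: mset_set_Diff)
qed

lemma cost_mset_set_le:
  assumes "finite C" "C \<noteq> {}" "finite X" "Q \<subseteq> X" "real (card (X - Q)) \<le> z"
  shows "cost d (mset_set X) z C \<le> sum_sqdist d Q C"
  unfolding sum_sqdist_def sum_unfold_sum_mset using assms
  by (intro cost_le) (auto simp: subset_imp_msubset_mset_set simp flip: mset_set_Diff)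

lemma centersD:
  assumes "C \<in> centers d k" "1 \<le> k"
  shows "finite C" "C \<noteq> {}"
  using assms by (auto simp: centers_def)

lemma infinite_Euclidean_space:
  assumes "1 \<le> d"
  shows "infinite (topspace (Euclidean_space d))"
proof (rule infinite_super)
  let ?axis = "\<lambda>t i. if i = (0::nat) then t else 0 :: real"
  show "range ?axis \<subseteq> topspace (Euclidean_space d)"
    using assms by (auto simp: topspace_Euclidean_space)
  have "inj ?axis"
    by (rule injI) (metis (mono_tags))
  then show "infinite (range ?axis)"
    by (simp add: range_inj_infinite finite_image_iff infinite_UNIV_char_0)
qed

lemma centers_nonempty:
  assumes "1 \<le> d"
  shows "centers d k \<noteq> {}"
  using infinite_arbitrarily_large[OF infinite_Euclidean_space[OF assms], of k]
  by (auto simp: centers_def)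

lemma Opt_le: "C \<in> centers d k \<Longrightarrow> Opt d P k z \<le> cost d P z C"
  unfolding Opt_def by (rule cINF_lower) (auto intro!: bdd_belowI2[where m = 0])

lemma Opt_greatest:
  "\<lbrakk>1 \<le> d; \<And>C. C \<in> centers d k \<Longrightarrow> b \<le> cost d P z C\<rbrakk> \<Longrightarrow> b \<le> Opt d P k z"
  unfolding Opt_def by (intro cINF_greatest centers_nonempty)

lemma Opt_nonneg: "1 \<le> d \<Longrightarrow> 0 \<le> Opt d P k z"
  by (rule Opt_greatest) auto

lemma discrete_centers:
  assumes "1 \<le> k" "0 \<le> z" and V_superset: "finite V" "X \<subseteq> V" "k \<le> card V"
    and D_centers: "D \<in> centers d k"
  obtains C where "C \<subseteq> V" "card C = k" "cost d (mset_set X) z C \<le> 4 * cost d (mset_set X) z D"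
proof -
  have fin_X: "finite X" and "V \<noteq> {}"
    using V_superset \<open>1 \<le> k\<close> finite_subset by auto
  note fin_D = centersD[OF D_centers \<open>1 \<le> k\<close>]
  obtain Q where Q_attains: "Q \<subseteq> X" "real (card (X - Q)) \<le> z"
    "cost d (mset_set X) z D = sum_sqdist d Q D"
    using cost_mset_set_attained[OF fin_X \<open>0 \<le> z\<close>] .
  have "nearest d V ` D \<subseteq> V"
    using nearest_in[OF V_superset(1) \<open>V \<noteq> {}\<close>] by auto
  moreover have "card (nearest d V ` D) \<le> k"
    using card_image_le[OF fin_D(1), of "nearest d V"] D_centers by (simp add: centers_def)
  ultimately obtain C where C_covers: "nearest d V ` D \<subseteq> C" "C \<subseteq> V" "card C = k"
    using exists_subset_between[OF _ V_superset(3) _ V_superset(1)] by blast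
  have fin_C: "finite C" "C \<noteq> {}"
    using C_covers V_superset(1) \<open>1 \<le> k\<close> finite_subset by auto
  have "sqdist_to d x C \<le> 4 * sqdist_to d x D" if "x \<in> Q" for x
  proof -
    have "sqdist_to d x C \<le> sqdist_to d x (nearest d V ` D)"
      using C_covers(1) fin_C(1) fin_D by (intro sqdist_to_antimono) auto
    also have "\<dots> \<le> 4 * sqdist_to d x D"
      using that Q_attains(1) V_superset fin_D by (intro sqdist_to_image_nearest_le) auto
    finally show ?thesis .
  qed
  then have "sum_sqdist d Q C \<le> 4 * sum_sqdist d Q D"
    by (simp add: sum_sqdist_def sum_distrib_left sum_mono)
  then show ?thesis
    using that[OF C_covers(2,3)] cost_mset_set_le[OF fin_C fin_X Q_attains(1,2)] Q_attains(3)
    by (metis order_trans)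
qed

text \<open>
  Only finitely many centre sets consist of points of a finite set \<open>V\<close>, so one of them is best;
  this avoids having to show that the infimum \<open>Opt\<close> is attained.
\<close>

lemma near_optimal_centers:
  assumes "1 \<le> d" "1 \<le> k" "finite X" "X \<subseteq> topspace (Euclidean_space d)" "0 \<le> z"
  obtains C where "C \<in> centers d k" "cost d (mset_set X) z C \<le> 4 * Opt d (mset_set X) k z"
proof -
  obtain B where B_centers: "B \<in> centers d k"
    using centers_nonempty[OF assms(1)] by blast
  define V where "V = X \<union> B"
  have V_superset: "finite V" "X \<subseteq> V" "V \<subseteq> topspace (Euclidean_space d)"
    using assms(3,4) B_centers by (auto simp: V_def centers_def)
  have "k \<le> card V"
    using B_centers assms(3) card_mono[of V B] by (simp add: V_def centers_def)
  define CC where "CC = {C. C \<subseteq> V \<and> card C = k}"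
  have CC_centers: "C \<in> centers d k" if "C \<in> CC" for C
    using that V_superset finite_subset by (auto simp: CC_def centers_def)
  have "finite CC"
    using V_superset(1) by (simp add: CC_def)
  moreover have "CC \<noteq> {}"
    using obtain_subset_with_card_n[OF \<open>k \<le> card V\<close>] by (auto simp: CC_def)
  ultimately obtain C where C_in_CC: "C \<in> CC"
    and best: "\<And>C'. C' \<in> CC \<Longrightarrow> cost d (mset_set X) z C \<le> cost d (mset_set X) z C'"
    using arg_min_if_finite(1) arg_min_least by metis
  have "cost d (mset_set X) z C / 4 \<le> Opt d (mset_set X) k z"
  proof (rule Opt_greatest[OF assms(1)])
    fix D assume "D \<in> centers d k"
    then obtain C' where "C' \<in> CC" "cost d (mset_set X) z C' \<le> 4 * cost d (mset_set X) z D"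
      using discrete_centers[OF assms(2,5) V_superset(1,2) \<open>k \<le> card V\<close>] unfolding CC_def by blast
    then show "cost d (mset_set X) z C / 4 \<le> cost d (mset_set X) z D"
      using best[of C'] by simp
  qed
  then show ?thesis
    using that[OF CC_centers[OF C_in_CC]] by simp
qed

section \<open>Composing and perturbing coresets\<close>

lemma is_coreset_refl: "is_coreset d k 1 1 X z X z"
  by (simp add: is_coreset_def)

lemma is_coreset_trans:
  assumes "is_coreset d k \<alpha>\<^sub>1 \<beta>\<^sub>1 Y z\<^sub>Y S z\<^sub>S" "is_coreset d k \<alpha>\<^sub>2 \<beta>\<^sub>2 S z\<^sub>S X z\<^sub>X"
    and "1 \<le> \<alpha>\<^sub>1" "1 \<le> \<beta>\<^sub>1"
  shows "is_coreset d k (\<alpha>\<^sub>1 * \<alpha>\<^sub>2) (\<beta>\<^sub>1 * \<beta>\<^sub>2) Y z\<^sub>Y X z\<^sub>X"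
  unfolding is_coreset_def
proof (intro ballI allI impI)
  fix C and \<kappa>\<^sub>1 \<kappa>\<^sub>2 :: real
  assume C_centers: "C \<in> centers d k" and factors_ge_1: "1 \<le> \<kappa>\<^sub>1" "1 \<le> \<kappa>\<^sub>2"
    and Y_approx: "cost d Y (\<kappa>\<^sub>1 * z\<^sub>Y) C \<le> \<kappa>\<^sub>2 * Opt d Y k z\<^sub>Y"
  have "cost d S (\<alpha>\<^sub>1 * \<kappa>\<^sub>1 * z\<^sub>S) C \<le> \<beta>\<^sub>1 * \<kappa>\<^sub>2 * Opt d S k z\<^sub>S"
    using assms(1) C_centers factors_ge_1 Y_approx by (auto simp: is_coreset_def)
  moreover have "1 \<le> \<alpha>\<^sub>1 * \<kappa>\<^sub>1" "1 \<le> \<beta>\<^sub>1 * \<kappa>\<^sub>2"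
    using assms(3,4) factors_ge_1 mult_mono[of 1 \<alpha>\<^sub>1 1 \<kappa>\<^sub>1] mult_mono[of 1 \<beta>\<^sub>1 1 \<kappa>\<^sub>2] by auto
  ultimately have "cost d X (\<alpha>\<^sub>2 * (\<alpha>\<^sub>1 * \<kappa>\<^sub>1) * z\<^sub>X) C \<le> \<beta>\<^sub>2 * (\<beta>\<^sub>1 * \<kappa>\<^sub>2) * Opt d X k z\<^sub>X"
    using assms(2) C_centers unfolding is_coreset_def by blast
  then show "cost d X (\<alpha>\<^sub>1 * \<alpha>\<^sub>2 * \<kappa>\<^sub>1 * z\<^sub>X) C \<le> \<beta>\<^sub>1 * \<beta>\<^sub>2 * \<kappa>\<^sub>2 * Opt d X k z\<^sub>X"
    by (simp add: ac_simps)
qed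

lemma is_coreset_mono:
  assumes "is_coreset d k \<alpha> \<beta> Y z' X z" "\<alpha> \<le> \<alpha>'" "\<beta> \<le> \<beta>'" "1 \<le> d" "1 \<le> k" "0 \<le> \<alpha>" "0 \<le> z"
  shows "is_coreset d k \<alpha>' \<beta>' Y z' X z"
  unfolding is_coreset_def
proof (intro ballI allI impI)
  fix C and \<kappa>\<^sub>1 \<kappa>\<^sub>2 :: real
  assume C_centers: "C \<in> centers d k" and factors_ge_1: "1 \<le> \<kappa>\<^sub>1" "1 \<le> \<kappa>\<^sub>2"
    and Y_approx: "cost d Y (\<kappa>\<^sub>1 * z') C \<le> \<kappa>\<^sub>2 * Opt d Y k z'"
  have "cost d X (\<alpha>' * \<kappa>\<^sub>1 * z) C \<le> cost d X (\<alpha> * \<kappa>\<^sub>1 * z) C"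
    using assms factors_ge_1 by (intro cost_antimono centersD[OF C_centers] mult_right_mono) auto
  also have "\<dots> \<le> \<beta> * \<kappa>\<^sub>2 * Opt d X k z"
    using assms(1) C_centers factors_ge_1 Y_approx by (auto simp: is_coreset_def)
  also have "\<dots> \<le> \<beta>' * \<kappa>\<^sub>2 * Opt d X k z"
    using assms factors_ge_1 by (intro mult_right_mono Opt_nonneg) auto
  finally show "cost d X (\<alpha>' * \<kappa>\<^sub>1 * z) C \<le> \<beta>' * \<kappa>\<^sub>2 * Opt d X k z" .
qed

lemma cost_image_mset_le:
  assumes fin_C: "finite C" "C \<noteq> {}" and z_nonneg: "0 \<le> z"
  shows "cost d (image_mset s M) z C \<le>
    2 * (\<Sum>x\<in>#M. sqdist d (s x) (t x)) + 2 * cost d (image_mset t M) z C"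
proof -
  obtain T where T_attains: "T \<subseteq># image_mset t M" "real (size (image_mset t M - T)) \<le> z"
    "cost d (image_mset t M) z C = (\<Sum>y\<in>#T. sqdist_to d y C)"
    using cost_attained z_nonneg by blast
  obtain N N' where M_split: "M = N + N'" and T_eq: "T = image_mset t N"
    using T_attains(1) image_mset_eq_plusD[of t M T "image_mset t M - T"] by auto
  have "cost d (image_mset s M) z C \<le> (\<Sum>y\<in>#image_mset s N. sqdist_to d y C)"
    using T_attains(2) by (intro cost_le fin_C) (auto simp: M_split T_eq)
  also have "\<dots> = (\<Sum>x\<in>#N. sqdist_to d (s x) C)"
    by (simp add: image_mset.compositionality comp_def)
  also have "\<dots> \<le> (\<Sum>x\<in>#N. 2 * sqdist d (s x) (t x) + 2 * sqdist_to d (t x) C)"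
    by (intro sum_mset_mono sqdist_to_triangle fin_C)
  also have "\<dots> = 2 * (\<Sum>x\<in>#N. sqdist d (s x) (t x)) + 2 * cost d (image_mset t M) z C"
    by (simp add: T_attains(3) T_eq sum_mset.distrib sum_mset_distrib_left
        image_mset.compositionality comp_def)
  also have "\<dots> \<le> 2 * (\<Sum>x\<in>#M. sqdist d (s x) (t x)) + 2 * cost d (image_mset t M) z C"
    by (simp add: M_split sum_mset_nonneg)
  finally show ?thesis .
qed

lemma Opt_image_mset_le:
  assumes "1 \<le> d" "1 \<le> k" "0 \<le> z"
  shows "Opt d (image_mset s M) k z \<le>
    2 * (\<Sum>x\<in>#M. sqdist d (s x) (t x)) + 2 * Opt d (image_mset t M) k z"
proof -
  let ?\<Delta> = "\<Sum>x\<in>#M. sqdist d (s x) (t x)"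
  have "Opt d (image_mset s M) k z / 2 - ?\<Delta> \<le> Opt d (image_mset t M) k z"
  proof (rule Opt_greatest[OF assms(1)])
    fix C assume C_centers: "C \<in> centers d k"
    have "Opt d (image_mset s M) k z \<le> cost d (image_mset s M) z C"
      by (rule Opt_le[OF C_centers])
    also have "\<dots> \<le> 2 * ?\<Delta> + 2 * cost d (image_mset t M) z C"
      by (intro cost_image_mset_le centersD[OF C_centers] assms)
    finally show "Opt d (image_mset s M) k z / 2 - ?\<Delta> \<le> cost d (image_mset t M) z C"
      by simp
  qed
  then show ?thesis
    by simp
qed

lemma is_coreset_image_mset:
  assumes dk_ge_1: "1 \<le> d" "1 \<le> k" and z_nonneg: "0 \<le> z"
    and moved: "(\<Sum>x\<in>#X. sqdist d x (t x)) \<le> B * Opt d X k z"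
  shows "is_coreset d k 1 (6 * B + 4) (image_mset t X) z X z"
  unfolding is_coreset_def
proof (intro ballI allI impI)
  fix C and \<kappa>\<^sub>1 \<kappa>\<^sub>2 :: real
  assume C_centers: "C \<in> centers d k" and factors_ge_1: "1 \<le> \<kappa>\<^sub>1" "1 \<le> \<kappa>\<^sub>2"
    and Y_approx: "cost d (image_mset t X) (\<kappa>\<^sub>1 * z) C \<le> \<kappa>\<^sub>2 * Opt d (image_mset t X) k z"
  define \<Delta> where "\<Delta> = (\<Sum>x\<in>#X. sqdist d x (t x))"
  have moved_le: "0 \<le> \<Delta>" "\<Delta> \<le> B * Opt d X k z"
    using moved by (simp_all add: \<Delta>_def sum_mset_nonneg)
  have "Opt d (image_mset t X) k z \<le> 2 * \<Delta> + 2 * Opt d X k z"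
    using Opt_image_mset_le[OF dk_ge_1 z_nonneg, of t X "\<lambda>x. x"] by (simp add: \<Delta>_def sqdist_commute)
  then have Opt_le: "\<kappa>\<^sub>2 * Opt d (image_mset t X) k z \<le> \<kappa>\<^sub>2 * (2 * \<Delta> + 2 * Opt d X k z)"
    using factors_ge_1 by (intro mult_left_mono) auto
  have "cost d X (\<kappa>\<^sub>1 * z) C \<le> 2 * \<Delta> + 2 * cost d (image_mset t X) (\<kappa>\<^sub>1 * z) C"
    using cost_image_mset_le[OF centersD[OF C_centers dk_ge_1(2)], of "\<kappa>\<^sub>1 * z" d "\<lambda>x. x" X t]
      z_nonneg factors_ge_1
    by (simp add: \<Delta>_def)
  also have "\<dots> \<le> 2 * (\<kappa>\<^sub>2 * \<Delta>) + 2 * (\<kappa>\<^sub>2 * (2 * \<Delta> + 2 * Opt d X k z))"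
    using Y_approx Opt_le mult_right_mono[OF factors_ge_1(2) moved_le(1)] by simp
  also have "\<dots> = \<kappa>\<^sub>2 * (6 * \<Delta> + 4 * Opt d X k z)"
    by (simp add: algebra_simps)
  also have "\<dots> \<le> \<kappa>\<^sub>2 * (6 * (B * Opt d X k z) + 4 * Opt d X k z)"
    using moved_le(2) factors_ge_1 by (intro mult_left_mono) auto
  finally show "cost d X (1 * \<kappa>\<^sub>1 * z) C \<le> (6 * B + 4) * \<kappa>\<^sub>2 * Opt d X k z"
    by (simp add: algebra_simps)
qed

section \<open>Reference clusterings\<close>

definition cluster :: "('a \<Rightarrow> 'b) \<Rightarrow> 'a set \<Rightarrow> 'b \<Rightarrow> 'a set" where
  "cluster g A j = {x \<in> A. g x = j}"

definition assigned_cost :: "nat \<Rightarrow> (point \<Rightarrow> point) \<Rightarrow> point set \<Rightarrow> real" where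
  "assigned_cost d g A = (\<Sum>x\<in>A. sqdist d x (g x))"

lemma finite_cluster [simp]: "finite A \<Longrightarrow> finite (cluster g A j)"
  by (simp add: cluster_def)

lemma sum_clusters:
  assumes "finite A" "finite J"
  shows "(\<Sum>j\<in>J. \<Sum>x\<in>cluster g A j. f x) = (\<Sum>x\<in>A \<inter> g -` J. f x)"
proof -
  have "(\<Sum>j\<in>J. \<Sum>x\<in>cluster g A j. f x) = (\<Sum>j\<in>J. \<Sum>x | x \<in> A \<inter> g -` J \<and> g x = j. f x)"
    by (intro sum.cong) (auto simp: cluster_def)
  also have "\<dots> = (\<Sum>x\<in>A \<inter> g -` J. f x)"
    using assms by (intro sum.group) auto
  finally show ?thesis .
qed

lemma sum_card_clusters:
  "\<lbrakk>finite A; finite J\<rbrakk> \<Longrightarrow> (\<Sum>j\<in>J. real (card (cluster g A j))) = real (card (A \<inter> g -` J))"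
  using sum_clusters[where f = "\<lambda>_. 1 :: real"] by simp

lemma sum_sqdist_clusters:
  "\<lbrakk>finite A; finite J\<rbrakk> \<Longrightarrow>
    (\<Sum>j\<in>J. sum_sqdist d (cluster g A j) C) = sum_sqdist d (A \<inter> g -` J) C"
  unfolding sum_sqdist_def by (rule sum_clusters)

lemma sum_sqdist_own_clusters:
  assumes "finite A" "finite J"
  shows "(\<Sum>j\<in>J. sum_sqdist d (cluster g A j) {j}) = assigned_cost d g (A \<inter> g -` J)"
proof -
  have "sum_sqdist d (cluster g A j) {j} = (\<Sum>x\<in>cluster g A j. sqdist d x (g x))" for j
    by (simp add: sum_sqdist_def cluster_def)
  then show ?thesis
    by (simp add: sum_clusters[OF assms] assigned_cost_def)
qed

lemma assigned_cost_nonneg [simp]: "0 \<le> assigned_cost d g A"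
  by (simp add: assigned_cost_def sum_nonneg)

lemma assigned_cost_mono: "\<lbrakk>finite B; A \<subseteq> B\<rbrakk> \<Longrightarrow> assigned_cost d g A \<le> assigned_cost d g B"
  unfolding assigned_cost_def by (intro sum_mono2) auto

locale outlier_clustering =
  fixes d k :: nat and X :: "point set" and z :: real and C Q :: "point set" and g :: "point \<Rightarrow> point"
  assumes k_ge_1: "1 \<le> k" and finite_X: "finite X" and centers: "C \<in> centers d k"
    and inliers: "Q \<subseteq> X" and card_outliers: "real (card (X - Q)) \<le> z" and g_in: "\<And>x. g x \<in> C"
begin

lemmas finite_C = centersD(1)[OF centers k_ge_1]
  and C_nonempty = centersD(2)[OF centers k_ge_1]

lemma finite_Q: "finite Q"
  using inliers finite_X by (rule finite_subset)

definition split_outliers :: "point \<Rightarrow> point" where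
  "split_outliers x = (if x \<in> Q then g x else x)"

lemma card_split_outliers: "card (split_outliers ` X) \<le> k + nat \<lfloor>z\<rfloor>"
proof -
  have "card (split_outliers ` X) \<le> card (C \<union> (X - Q))"
    using finite_C finite_X g_in by (intro card_mono) (auto simp: split_outliers_def)
  also have "\<dots> \<le> k + card (X - Q)"
    using card_Un_le[of C "X - Q"] centers by (simp add: centers_def)
  finally show ?thesis
    using card_outliers by linarith
qed

lemma assigned_cost_split_outliers: "assigned_cost d split_outliers X = assigned_cost d g Q"
  unfolding assigned_cost_def using finite_X inliers
  by (intro sum.mono_neutral_cong_right) (auto simp: split_outliers_def)

end

lemma near_optimal_clustering:
  assumes "1 \<le> d" "1 \<le> k" "finite X" "X \<subseteq> topspace (Euclidean_space d)" "0 \<le> z"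
  obtains C Q g where "outlier_clustering d k X z C Q g"
    "assigned_cost d g Q \<le> 4 * Opt d (mset_set X) k z"
proof -
  obtain C where C_near_opt: "C \<in> centers d k"
    "cost d (mset_set X) z C \<le> 4 * Opt d (mset_set X) k z"
    using near_optimal_centers assms by blast
  note fin_C = centersD[OF C_near_opt(1) assms(2)]
  obtain Q where Q_attains: "Q \<subseteq> X" "real (card (X - Q)) \<le> z"
    "cost d (mset_set X) z C = sum_sqdist d Q C"
    using cost_mset_set_attained[OF assms(3,5)] .
  have "outlier_clustering d k X z C Q (nearest d C)"
    using assms(2,3) C_near_opt(1) Q_attains(1,2) fin_C by unfold_locales (auto intro: nearest_in)
  moreover have "assigned_cost d (nearest d C) Q = sum_sqdist d Q C"
    by (simp add: assigned_cost_def sum_sqdist_def sqdist_to_eq_nearest fin_C)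
  ultimately show ?thesis
    using that C_near_opt(2) Q_attains(3) by simp
qed

section \<open>\<open>D\<^sup>2\<close>-sampling\<close>

definition d2_step :: "nat \<Rightarrow> point set \<Rightarrow> point list \<Rightarrow> point list pmf" where
  "d2_step d P ys =
     (if P \<subseteq> set ys then return_pmf ys else map_pmf (\<lambda>y. ys @ [y]) (d2_next d P ys))"

lemma d2_sample_Suc: "d2_sample d P (Suc m) = bind_pmf (d2_sample d P m) (d2_step d P)"
  by (simp add: d2_step_def[abs_def])

lemma pmf_d2_next:
  assumes "finite P" "P \<subseteq> topspace (Euclidean_space d)" "ys \<noteq> []" "set ys \<subseteq> P" "\<not> P \<subseteq> set ys"
  shows "pmf (d2_next d P ys) x =
    (if x \<in> P then sqdist_to d x (set ys) / sum_sqdist d P (set ys) else 0)"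
proof -
  obtain u where u_new: "u \<in> P" "u \<notin> set ys"
    using assms(5) by blast
  have "0 < sqdist_to d u (set ys)"
    using u_new assms by (intro sqdist_to_pos) auto
  then have pos: "0 < sum_sqdist d P (set ys)"
    unfolding sum_sqdist_def using u_new assms(1) by (intro sum_pos2[of P u]) auto
  let ?f = "\<lambda>x. if x \<in> P then sqdist_to d x (set ys) / sum_sqdist d P (set ys) else 0"
  have "(\<integral>\<^sup>+x. ennreal (?f x) \<partial>count_space UNIV) = (\<Sum>x\<in>P. ennreal (?f x))"
    using assms(1) by (intro nn_integral_count_space'[THEN trans]) (auto split: if_splits)
  also have "\<dots> = ennreal (\<Sum>x\<in>P. ?f x)"
    using pos by (intro sum_ennreal) auto
  also have "(\<Sum>x\<in>P. ?f x) = 1"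
    using pos by (simp add: sum_sqdist_def flip: sum_divide_distrib)
  finally have "pmf (embed_pmf ?f) x = ?f x"
    using pos by (intro pmf_embed_pmf) auto
  then show ?thesis
    using assms(3) unfolding d2_next_def sqdist_to_def sum_sqdist_def by simp
qed

lemma prob_d2_next:
  assumes "finite P" "P \<subseteq> topspace (Euclidean_space d)" "ys \<noteq> []" "set ys \<subseteq> P" "\<not> P \<subseteq> set ys" "H \<subseteq> P"
  shows "measure_pmf.prob (d2_next d P ys) H = sum_sqdist d H (set ys) / sum_sqdist d P (set ys)"
proof -
  have "measure_pmf.prob (d2_next d P ys) H = (\<Sum>x\<in>H. pmf (d2_next d P ys) x)"
    using assms finite_subset by (intro measure_measure_pmf_finite) blast
  also have "\<dots> = (\<Sum>x\<in>H. sqdist_to d x (set ys) / sum_sqdist d P (set ys))"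
    using assms by (intro sum.cong) (auto simp: pmf_d2_next)
  finally show ?thesis
    by (simp add: sum_sqdist_def sum_divide_distrib)
qed

lemma set_pmf_d2_next:
  assumes "finite P" "P \<subseteq> topspace (Euclidean_space d)" "set ys \<subseteq> P" "\<not> P \<subseteq> set ys"
  shows "set_pmf (d2_next d P ys) \<subseteq> P"
proof (cases "ys = []")
  case True
  then show ?thesis
    using assms by (auto simp: d2_next_def set_pmf_of_set)
next
  case False
  then show ?thesis
    using assms by (auto simp: set_pmf_eq pmf_d2_next)
qed

lemma finite_set_pmf_d2_next:
  assumes "finite P" "P \<subseteq> topspace (Euclidean_space d)" "set ys \<subseteq> P" "\<not> P \<subseteq> set ys"
  shows "finite (set_pmf (d2_next d P ys))"
  using set_pmf_d2_next[OF assms] assms(1) by (rule finite_subset)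

lemma set_pmf_d2_step:
  assumes "finite P" "P \<subseteq> topspace (Euclidean_space d)" "set ys \<subseteq> P" "ys' \<in> set_pmf (d2_step d P ys)"
  shows "set ys \<subseteq> set ys'" "set ys' \<subseteq> P" "length ys' \<le> Suc (length ys)" "P \<noteq> {} \<Longrightarrow> ys' \<noteq> []"
  using assms set_pmf_d2_next[OF assms(1-3)] by (auto simp: d2_step_def split: if_splits)

lemma finite_set_pmf_d2_step:
  assumes "finite P" "P \<subseteq> topspace (Euclidean_space d)" "set ys \<subseteq> P"
  shows "finite (set_pmf (d2_step d P ys))"
  by (rule finite_subset[OF _ finite_lists_length_le[OF assms(1), of "Suc (length ys)"]])
    (use set_pmf_d2_step[OF assms] in blast)

lemma set_pmf_d2_sample:
  assumes "finite P" "P \<subseteq> topspace (Euclidean_space d)" "ys \<in> set_pmf (d2_sample d P m)"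
  shows "set ys \<subseteq> P \<and> length ys \<le> m \<and> (P \<noteq> {} \<and> 1 \<le> m \<longrightarrow> ys \<noteq> [])"
  using assms(3)
proof (induction m arbitrary: ys)
  case 0
  then show ?case by simp
next
  case (Suc m)
  then obtain xs where xs_step: "xs \<in> set_pmf (d2_sample d P m)" "ys \<in> set_pmf (d2_step d P xs)"
    by (auto simp: d2_sample_Suc simp del: d2_sample.simps)
  with Suc.IH show ?case
    using set_pmf_d2_step[OF assms(1,2) _ xs_step(2)] by fastforce
qed

lemma finite_set_pmf_d2_sample:
  assumes "finite P" "P \<subseteq> topspace (Euclidean_space d)"
  shows "finite (set_pmf (d2_sample d P m))"
  by (rule finite_subset[OF _ finite_lists_length_le[OF assms(1), of m]])
    (use set_pmf_d2_sample[OF assms] in blast)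

lemma card_le_multiple_of_mean:
  fixes f :: "'a \<Rightarrow> real"
  assumes "finite A" "\<And>x. x \<in> A \<Longrightarrow> 0 \<le> f x" "0 < t"
  shows "(1 - 1 / t) * real (card A) \<le> real (card {x \<in> A. real (card A) * f x \<le> t * sum f A})"
proof -
  define B where "B = {x \<in> A. real (card A) * f x \<le> t * sum f A}"
  have B_subset: "finite B" "B \<subseteq> A"
    using assms(1) by (auto simp: B_def)
  have "t * real (card (A - B)) \<le> real (card A)"
  proof (cases "sum f A = 0")
    case True
    then have "B = A"
      using assms by (auto simp: B_def sum_nonneg_eq_0_iff)
    then show ?thesis by simp
  next
    case False
    then have pos: "0 < sum f A"
      using assms(2) by (simp add: sum_nonneg less_le)
    have "real (card (A - B)) * (t * sum f A) \<le> (\<Sum>x\<in>A - B. real (card A) * f x)"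
      by (rule sum_bounded_below) (auto simp: B_def)
    also have "\<dots> \<le> (\<Sum>x\<in>A. real (card A) * f x)"
      using assms by (intro sum_mono2) auto
    finally have "t * real (card (A - B)) * sum f A \<le> real (card A) * sum f A"
      by (simp add: mult_ac flip: sum_distrib_left sum_distrib_right)
    then show ?thesis
      using pos by simp
  qed
  moreover have "real (card (A - B)) = real (card A) - real (card B)"
    using assms(1) B_subset by (simp add: card_Diff_subset card_mono of_nat_diff)
  ultimately have "t * (real (card A) - real (card B)) \<le> real (card A)"
    by simp
  then show ?thesis
    unfolding B_def[symmetric] using assms(3) by (simp add: field_simps)
qed

lemma sum_sqdist_le_relay:
  assumes "finite C" "C \<noteq> {}"
  shows "sum_sqdist d A C \<le>
    4 * sum_sqdist d A {c} + real (card A) * (4 * sqdist d s c + 2 * sqdist_to d s C)"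
proof -
  have "sum_sqdist d A C \<le> (\<Sum>x\<in>A. 4 * sqdist d x c + (4 * sqdist d s c + 2 * sqdist_to d s C))"
    unfolding sum_sqdist_def using sqdist_to_relay[OF assms]
    by (intro sum_mono) (simp add: add.assoc)
  then show ?thesis
    by (simp add: sum.distrib sum_sqdist_def flip: sum_distrib_left)
qed

lemma sum_sqdist_insert_le:
  assumes "finite C"
  shows "sum_sqdist d A (insert s C) \<le> 2 * sum_sqdist d A {c} + 2 * (real (card A) * sqdist d s c)"
proof -
  have "sqdist_to d x (insert s C) \<le> 2 * sqdist d x c + 2 * sqdist d s c" for x
    using sqdist_to_le[of "insert s C" s d x] sqdist_triangle[of d x s c] assms
    by (simp add: sqdist_commute)
  then have "sum_sqdist d A (insert s C) \<le> (\<Sum>x\<in>A. 2 * sqdist d x c + 2 * sqdist d s c)"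
    unfolding sum_sqdist_def by (intro sum_mono)
  then show ?thesis
    by (simp add: sum.distrib sum_sqdist_def flip: sum_distrib_left)
qed

text \<open>
  By averaging, three quarters of \<open>A\<close> are within twice the root mean square radius of \<open>c\<close>.
  Opening any one of these points makes the cluster cheap, and as \<open>C\<close> is far away, they carry a
  constant fraction of the weight.
\<close>

lemma expensive_cluster_sample:
  assumes fin_A: "finite A" and fin_C: "finite C" "C \<noteq> {}"
    and expensive: "30 * sum_sqdist d A {c} \<le> sum_sqdist d A C"
  shows "sum_sqdist d A C / 8 \<le>
    sum_sqdist d {x \<in> A. sum_sqdist d A (insert x C) \<le> 10 * sum_sqdist d A {c}} C"
proof (cases "A = {}")
  case True
  then show ?thesis
    by (simp add: sum_sqdist_def)
next
  case False
  define r where "r = sum_sqdist d A {c}"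
  define B where "B = {x \<in> A. real (card A) * sqdist d x c \<le> 4 * r}"
  have card_A: "0 < real (card A)"
    using False fin_A by (simp add: card_gt_0_iff)
  have card_B: "3 / 4 * real (card A) \<le> real (card B)"
    using card_le_multiple_of_mean[OF fin_A, of "\<lambda>x. sqdist d x c" 4]
    by (simp add: B_def r_def sum_sqdist_def)
  have "sum_sqdist d A C / 6 \<le> real (card A) * sqdist_to d x C" if "x \<in> B" for x
    using sum_sqdist_le_relay[OF fin_C, of d A c x] that expensive
    by (simp add: B_def r_def algebra_simps)
  then have "real (card B) * (sum_sqdist d A C / 6) \<le> (\<Sum>x\<in>B. real (card A) * sqdist_to d x C)"
    by (rule sum_bounded_below)
  moreover have "3 / 4 * real (card A) * (sum_sqdist d A C / 6)
      \<le> real (card B) * (sum_sqdist d A C / 6)"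
    using card_B by (intro mult_right_mono) auto
  ultimately have "real (card A) * (sum_sqdist d A C / 8) \<le> real (card A) * sum_sqdist d B C"
    by (simp add: sum_sqdist_def flip: sum_distrib_left)
  then have "sum_sqdist d A C / 8 \<le> sum_sqdist d B C"
    using card_A by (simp only: mult_le_cancel_left_pos)
  also have "\<dots> \<le> sum_sqdist d {x \<in> A. sum_sqdist d A (insert x C) \<le> 10 * r} C"
  proof (intro sum_sqdist_mono subsetI)
    fix x assume "x \<in> B"
    then show "x \<in> {x \<in> A. sum_sqdist d A (insert x C) \<le> 10 * r}"
      using sum_sqdist_insert_le[OF fin_C(1), of d A x c] by (simp add: B_def r_def)
  qed (use fin_A in simp)
  finally show ?thesis
    by (simp add: r_def)
qed

lemma expectation_bind_pmf_le:
  fixes h :: "'b \<Rightarrow> real"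
  assumes "finite (set_pmf M)" "\<And>x. x \<in> set_pmf M \<Longrightarrow> finite (set_pmf (f x))"
    and "\<And>x. x \<in> set_pmf M \<Longrightarrow> measure_pmf.expectation (f x) h \<le> u x"
  shows "measure_pmf.expectation (bind_pmf M f) h \<le> measure_pmf.expectation M u"
proof -
  have "measure_pmf.expectation (bind_pmf M f) h
      = (\<Sum>x\<in>set_pmf M. pmf M x *\<^sub>R measure_pmf.expectation (f x) h)"
    using assms by (intro pmf_expectation_bind) auto
  also have "\<dots> \<le> (\<Sum>x\<in>set_pmf M. pmf M x *\<^sub>R u x)"
    using assms by (intro sum_mono scaleR_left_mono) auto
  also have "\<dots> = measure_pmf.expectation M u"
    using assms by (intro integral_measure_pmf[symmetric]) auto
  finally show ?thesis .
qed

locale clustering =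
  fixes d :: nat and P :: "point set" and g :: "point \<Rightarrow> point"
  assumes finite_P: "finite P" and P_subset: "P \<subseteq> topspace (Euclidean_space d)"
    and P_nonempty: "P \<noteq> {}"
begin

definition expensive :: "point set \<Rightarrow> point set" where
  "expensive C =
     {j \<in> g ` P. 30 * sum_sqdist d (cluster g P j) {j} < sum_sqdist d (cluster g P j) C}"

definition repairing :: "point set \<Rightarrow> point set" where
  "repairing C = {x \<in> P. g x \<in> expensive C - expensive (insert x C)}"

definition too_costly :: "point set \<Rightarrow> bool" where
  "too_costly C \<longleftrightarrow> 60 * assigned_cost d g P < sum_sqdist d P C"

lemma finite_expensive [simp]: "finite (expensive C)"
  using finite_P by (simp add: expensive_def)

lemma expensive_antimono:
  assumes "finite C" "B \<subseteq> C" "B \<noteq> {}"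
  shows "expensive C \<subseteq> expensive B"
proof
  fix j assume "j \<in> expensive C"
  then show "j \<in> expensive B"
    using sum_sqdist_antimono[OF assms, of d "cluster g P j"] by (simp add: expensive_def)
qed

lemma too_costly_not_covered:
  assumes "too_costly C" "finite C"
  shows "\<not> P \<subseteq> C"
proof
  assume "P \<subseteq> C"
  then have "sum_sqdist d P C = 0"
    by (rule sum_sqdist_eq_0[OF assms(2)])
  then show False
    using assms(1) assigned_cost_nonneg[of d g P] by (simp add: too_costly_def)
qed

lemma sum_sqdist_expensive_ge:
  assumes "too_costly C"
  shows "sum_sqdist d P C / 2 \<le> (\<Sum>j\<in>expensive C. sum_sqdist d (cluster g P j) C)"
proof -
  have P_clustered: "P \<inter> g -` g ` P = P"
    by auto
  have "(\<Sum>j\<in>g ` P - expensive C. sum_sqdist d (cluster g P j) C)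
      \<le> (\<Sum>j\<in>g ` P - expensive C. 30 * sum_sqdist d (cluster g P j) {j})"
    by (intro sum_mono) (auto simp: expensive_def)
  also have "\<dots> \<le> (\<Sum>j\<in>g ` P. 30 * sum_sqdist d (cluster g P j) {j})"
    using finite_P by (intro sum_mono2) auto
  also have "\<dots> = 30 * assigned_cost d g P"
    using finite_P by (simp add: sum_sqdist_own_clusters P_clustered flip: sum_distrib_left)
  also have "\<dots> \<le> sum_sqdist d P C / 2"
    using assms by (simp add: too_costly_def)
  finally show ?thesis
    using sum_sqdist_clusters[of P "g ` P" d g C] finite_P
      sum.subset_diff[of "expensive C" "g ` P" "\<lambda>j. sum_sqdist d (cluster g P j) C"]
    by (auto simp: P_clustered expensive_def)
qed

lemma sum_sqdist_repairing_ge: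
  assumes "too_costly C" and fin_C: "finite C" "C \<noteq> {}"
  shows "sum_sqdist d P C / 16 \<le> sum_sqdist d (repairing C) C"
proof -
  define G where
    "G j = {x \<in> cluster g P j.
       sum_sqdist d (cluster g P j) (insert x C) \<le> 10 * sum_sqdist d (cluster g P j) {j}}"
    for j
  have "sum_sqdist d P C / 16 \<le> (\<Sum>j\<in>expensive C. sum_sqdist d (cluster g P j) C / 8)"
    using sum_sqdist_expensive_ge[OF assms(1)] by (simp flip: sum_divide_distrib)
  also have "\<dots> \<le> (\<Sum>j\<in>expensive C. sum_sqdist d (G j) C)"
    unfolding G_def using finite_P fin_C
    by (intro sum_mono expensive_cluster_sample) (auto simp: expensive_def)
  also have "\<dots> \<le> (\<Sum>j\<in>expensive C. sum_sqdist d (cluster g (repairing C) j) C)"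
  proof (intro sum_mono sum_sqdist_mono subsetI)
    fix j x assume "j \<in> expensive C" "x \<in> G j"
    have "sum_sqdist d (cluster g P j) (insert x C) \<le> 10 * sum_sqdist d (cluster g P j) {j}"
      using \<open>x \<in> G j\<close> by (simp add: G_def)
    also have "\<dots> \<le> 30 * sum_sqdist d (cluster g P j) {j}"
      by simp
    finally have "j \<notin> expensive (insert x C)"
      by (simp add: expensive_def)
    with \<open>j \<in> expensive C\<close> \<open>x \<in> G j\<close> show "x \<in> cluster g (repairing C) j"
      by (auto simp: G_def cluster_def repairing_def)
  qed (use finite_P in \<open>simp add: repairing_def\<close>)
  also have "\<dots> = sum_sqdist d (repairing C \<inter> g -` expensive C) C"
    using finite_P by (intro sum_sqdist_clusters) (auto simp: repairing_def)
  also have "repairing C \<inter> g -` expensive C = repairing C"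
    by (auto simp: repairing_def)
  finally show ?thesis .
qed

lemma prob_repairing_ge:
  assumes "too_costly (set ys)" "ys \<noteq> []" "set ys \<subseteq> P"
  shows "1 / 16 \<le> measure_pmf.prob (d2_next d P ys) (repairing (set ys))"
proof -
  have "0 < sum_sqdist d P (set ys)"
    using assms(1) assigned_cost_nonneg[of d g P] unfolding too_costly_def by linarith
  moreover have "sum_sqdist d P (set ys) / 16 \<le> sum_sqdist d (repairing (set ys)) (set ys)"
    using assms by (intro sum_sqdist_repairing_ge) auto
  moreover have "measure_pmf.prob (d2_next d P ys) (repairing (set ys))
      = sum_sqdist d (repairing (set ys)) (set ys) / sum_sqdist d P (set ys)"
    using assms finite_P P_subset too_costly_not_covered[OF assms(1)]
    by (intro prob_d2_next) (auto simp: repairing_def)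
  ultimately show ?thesis
    by (simp add: pos_le_divide_eq)
qed

lemma card_expensive_insert:
  assumes "finite C" "C \<noteq> {}"
  shows "real (card (expensive (insert x C))) \<le> real (card (expensive C)) - indicator (repairing C) x"
proof -
  have sub: "expensive (insert x C) \<subseteq> expensive C"
    using assms by (intro expensive_antimono) auto
  show ?thesis
  proof (cases "x \<in> repairing C")
    case True
    then have "card (expensive (insert x C)) < card (expensive C)"
      using sub by (intro psubset_card_mono) (auto simp: repairing_def)
    then show ?thesis
      using True by simp
  next
    case False
    then show ?thesis
      using sub by (simp add: card_mono)
  qed
qed

lemma expectation_card_expensive_insert:
  assumes costly_ys: "too_costly (set ys)" "ys \<noteq> []" "set ys \<subseteq> P"
  shows "measure_pmf.expectation (d2_next d P ys) (\<lambda>y. real (card (expensive (insert y (set ys)))))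
    \<le> real (card (expensive (set ys))) - 1 / 16"
proof -
  have fin: "finite (set_pmf (d2_next d P ys))"
    using costly_ys too_costly_not_covered by (intro finite_set_pmf_d2_next finite_P P_subset) auto
  have "measure_pmf.expectation (d2_next d P ys) (\<lambda>y. real (card (expensive (insert y (set ys)))))
      \<le> measure_pmf.expectation (d2_next d P ys)
          (\<lambda>y. real (card (expensive (set ys))) - indicator (repairing (set ys)) y)"
    using costly_ys(2)
    by (intro integral_mono integrable_measure_pmf_finite fin card_expensive_insert) auto
  also have "\<dots> = real (card (expensive (set ys)))
      - measure_pmf.prob (d2_next d P ys) (repairing (set ys))"
    by (subst Bochner_Integration.integral_diff) (auto intro: integrable_measure_pmf_finite[OF fin])
  finally show ?thesis
    using prob_repairing_ge[OF costly_ys] by linarith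
qed

text \<open>
  From the first draw on, \<open>potential n\<close> at time \<open>n + 1\<close> is a supermartingale: a step taken
  while the cost is too high repairs a cluster with probability at least \<open>1/16\<close>, which pays for
  the growing second term.
\<close>

definition potential :: "nat \<Rightarrow> point list \<Rightarrow> real" where
  "potential n ys = real (card (expensive (set ys))) + real n / 16 * of_bool (too_costly (set ys))"

lemma potential_cheap:
  assumes "\<not> too_costly (set ys)" "ys \<noteq> []" "set ys \<subseteq> set ys'"
  shows "potential n ys' \<le> potential m ys"
proof -
  have "sum_sqdist d P (set ys') \<le> sum_sqdist d P (set ys)"
    using assms by (intro sum_sqdist_antimono) auto
  then have "\<not> too_costly (set ys')"
    using assms(1) by (simp add: too_costly_def)
  moreover have "card (expensive (set ys')) \<le> card (expensive (set ys))"
    using assms by (intro card_mono expensive_antimono) auto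
  ultimately show ?thesis
    using assms(1) by (simp add: potential_def)
qed

lemma expectation_potential_costly:
  assumes costly_ys: "too_costly (set ys)" "ys \<noteq> []" "set ys \<subseteq> P"
  shows "measure_pmf.expectation (d2_step d P ys) (potential (Suc n)) \<le> potential n ys"
proof -
  have "\<not> P \<subseteq> set ys"
    using too_costly_not_covered costly_ys(1) by blast
  then have fin: "finite (set_pmf (d2_next d P ys))"
    by (rule finite_set_pmf_d2_next[OF finite_P P_subset costly_ys(3)])
  have "measure_pmf.expectation (d2_next d P ys) (\<lambda>y. potential (Suc n) (ys @ [y]))
     \<le> measure_pmf.expectation (d2_next d P ys)
         (\<lambda>y. real (card (expensive (insert y (set ys)))) + real (Suc n) / 16)"
    by (intro integral_mono integrable_measure_pmf_finite fin) (simp add: potential_def)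
  also have "\<dots> = measure_pmf.expectation (d2_next d P ys)
         (\<lambda>y. real (card (expensive (insert y (set ys))))) + real (Suc n) / 16"
    by (subst Bochner_Integration.integral_add) (auto intro: integrable_measure_pmf_finite[OF fin])
  also have "\<dots> \<le> potential n ys"
    using expectation_card_expensive_insert[OF costly_ys] costly_ys(1)
    by (simp add: potential_def field_simps)
  finally show ?thesis
    using \<open>\<not> P \<subseteq> set ys\<close> by (simp add: d2_step_def)
qed

lemma expectation_potential_step:
  assumes ys_in_P: "ys \<noteq> []" "set ys \<subseteq> P"
  shows "measure_pmf.expectation (d2_step d P ys) (potential (Suc n)) \<le> potential n ys"
proof (cases "too_costly (set ys)")
  case True
  then show ?thesis
    using ys_in_P by (rule expectation_potential_costly)
next
  case False
  then have "AE ys' in d2_step d P ys. potential (Suc n) ys' \<le> potential n ys"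
    using ys_in_P set_pmf_d2_step(1)[OF finite_P P_subset ys_in_P(2)]
    by (intro AE_pmfI potential_cheap) auto
  then show ?thesis
    by (intro measure_pmf.integral_le_const integrable_measure_pmf_finite finite_set_pmf_d2_step
        finite_P P_subset ys_in_P)
qed

lemma expectation_potential:
  "measure_pmf.expectation (d2_sample d P (Suc n)) (potential n) \<le> real (card (g ` P))"
proof (induction n)
  case 0
  have "potential 0 ys \<le> real (card (g ` P))" for ys
    unfolding potential_def using finite_P by (auto simp: expensive_def intro!: card_mono)
  then show ?case
    by (intro measure_pmf.integral_le_const AE_pmfI integrable_measure_pmf_finite
        finite_set_pmf_d2_sample finite_P P_subset)
next
  case (Suc n)
  have "measure_pmf.expectation (d2_sample d P (Suc (Suc n))) (potential (Suc n))
      \<le> measure_pmf.expectation (d2_sample d P (Suc n)) (potential n)"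
    unfolding d2_sample_Suc[of d P "Suc n"]
    using set_pmf_d2_sample[OF finite_P P_subset, of _ "Suc n"] P_nonempty
    by (intro expectation_bind_pmf_le expectation_potential_step finite_set_pmf_d2_step
        finite_set_pmf_d2_sample finite_P P_subset) auto
  with Suc.IH show ?case
    by simp
qed

lemma prob_too_costly_le:
  "real n * measure_pmf.prob (d2_sample d P (Suc n)) {ys. too_costly (set ys)}
    \<le> 16 * real (card (g ` P))"
proof -
  let ?M = "d2_sample d P (Suc n)"
  have "real n / 16 * measure_pmf.prob ?M {ys. too_costly (set ys)}
      = measure_pmf.expectation ?M (\<lambda>ys. real n / 16 * indicator {ys. too_costly (set ys)} ys)"
    by simp
  also have "\<dots> \<le> measure_pmf.expectation ?M (potential n)"
    by (intro integral_mono integrable_measure_pmf_finite finite_set_pmf_d2_sample finite_P P_subset)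
      (auto simp: potential_def indicator_def)
  also have "\<dots> \<le> real (card (g ` P))"
    by (rule expectation_potential)
  finally show ?thesis
    by simp
qed

lemma prob_d2_sample_not_too_costly:
  assumes "32 * card (g ` P) \<le> m"
  shows "15 / 31 \<le> measure_pmf.prob (d2_sample d P m) {ys. \<not> too_costly (set ys)}"
proof -
  define K where "K = card (g ` P)"
  have K_ge_1: "1 \<le> K"
    using finite_P P_nonempty by (simp add: K_def Suc_le_eq card_gt_0_iff)
  obtain n where m_eq: "m = Suc n"
    using assms K_ge_1 by (cases m) (auto simp: K_def)
  let ?p = "measure_pmf.prob (d2_sample d P m) {ys. too_costly (set ys)}"
  have "31 * real K \<le> real n"
    using assms K_ge_1 m_eq unfolding K_def[symmetric] by linarith
  then have "31 * real K * ?p \<le> real n * ?p"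
    by (intro mult_right_mono) auto
  also have "\<dots> \<le> 16 * real K"
    unfolding m_eq K_def by (rule prob_too_costly_le)
  finally have "?p \<le> 16 / 31"
    using K_ge_1 by (simp add: field_simps)
  moreover have "{ys. \<not> too_costly (set ys)} = UNIV - {ys. too_costly (set ys)}"
    by auto
  ultimately show ?thesis
    using measure_pmf.prob_compl[of "{ys. too_costly (set ys)}" "d2_sample d P m"] by simp
qed

end

section \<open>Coresets from \<open>D\<^sup>2\<close>-samples\<close>

lemma weighted_mset_eq_image_mset:
  assumes "finite P" "finite Y" "t ` P \<subseteq> Y"
  shows "weighted_mset Y (\<lambda>y. card {x \<in> P. t x = y}) = image_mset t (mset_set P)"
proof (rule multiset_eqI)
  fix a
  have "count (weighted_mset Y (\<lambda>y. card {x \<in> P. t x = y})) a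
      = (\<Sum>y\<in>Y. if y = a then card {x \<in> P. t x = y} else 0)"
    unfolding weighted_mset_def count_sum by (intro sum.cong) auto
  also have "\<dots> = card {x \<in> P. t x = a}"
    using assms by (auto simp: sum.delta' card_eq_0_iff)
  also have "\<dots> = count (image_mset t (mset_set P)) a"
    using assms(1) by (auto simp: count_image_mset intro!: arg_cong[where f = card])
  finally show "count (weighted_mset Y (\<lambda>y. card {x \<in> P. t x = y})) a = \<dots>" .
qed

lemma is_coreset_closest:
  assumes "1 \<le> d" "1 \<le> k" and P_points: "finite P" "P \<subseteq> topspace (Euclidean_space d)" and "0 \<le> z"
    and tau_closest: "closest_rule d \<tau>" and ys_in_P: "ys \<noteq> []" "set ys \<subseteq> P"
    and small: "sum_sqdist d P (set ys) \<le> B * Opt d (mset_set P) k z"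
  shows "is_coreset d k 1 (6 * B + 4)
    (weighted_mset (set ys) (\<lambda>y. card {x \<in> P. \<tau> ys x = y})) z (mset_set P) z"
proof -
  have closest: "\<tau> ys x \<in> set ys" "sqdist d x (\<tau> ys x) = sqdist_to d x (set ys)" if "x \<in> P" for x
    using tau_closest P_points ys_in_P that
    by (auto simp: closest_rule_def sqdist_def sqdist_to_def subset_iff)
  then have "(\<Sum>x\<in>#mset_set P. sqdist d x (\<tau> ys x)) = sum_sqdist d P (set ys)"
    by (simp add: sum_sqdist_def flip: sum_unfold_sum_mset)
  then have "is_coreset d k 1 (6 * B + 4) (image_mset (\<tau> ys) (mset_set P)) z (mset_set P) z"
    using assms by (intro is_coreset_image_mset) auto
  moreover have "weighted_mset (set ys) (\<lambda>y. card {x \<in> P. \<tau> ys x = y}) = image_mset (\<tau> ys) (mset_set P)"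
    using P_points closest by (intro weighted_mset_eq_image_mset) auto
  ultimately show ?thesis
    by simp
qed

lemma is_coreset_empty: "1 \<le> d \<Longrightarrow> 0 \<le> \<beta> \<Longrightarrow> is_coreset d k \<alpha> \<beta> Y z' {#} z"
  using trimmed_subset[of d "{#}"] by (auto simp: is_coreset_def cost_def Opt_nonneg)

lemma prob_kmeanspp_coreset:
  assumes dk_ge_1: "1 \<le> d" "1 \<le> k" and P_points: "finite P" "P \<subseteq> topspace (Euclidean_space d)"
    and z_nonneg: "0 \<le> z"
    and enough_draws: "32 * (k + nat \<lfloor>z\<rfloor>) \<le> m" and tau_closest: "closest_rule d \<tau>"
  shows "15 / 31 \<le> measure_pmf.prob (kmeanspp d \<tau> P m)
    {(Y, w). is_coreset d k 1 1444 (weighted_mset Y w) z (mset_set P) z}"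
proof (cases "P = {}")
  case True
  then show ?thesis
    using is_coreset_empty[OF dk_ge_1(1)] by simp
next
  case False
  obtain C Q g where outlier: "outlier_clustering d k P z C Q g"
    and near_opt: "assigned_cost d g Q \<le> 4 * Opt d (mset_set P) k z"
    using near_optimal_clustering[OF dk_ge_1 P_points z_nonneg] .
  interpret outlier_clustering d k P z C Q g
    by (fact outlier)
  interpret clustering d P split_outliers
    using P_points False by unfold_locales
  let ?coreset = "\<lambda>ys. is_coreset d k 1 1444
    (weighted_mset (set ys) (\<lambda>y. card {x \<in> P. \<tau> ys x = y})) z (mset_set P) z"
  have "?coreset ys" if ys_cheap: "ys \<in> set_pmf (d2_sample d P m)" "\<not> too_costly (set ys)" for ys
  proof -
    have "sum_sqdist d P (set ys) \<le> 240 * Opt d (mset_set P) k z"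
      using ys_cheap(2) near_opt by (simp add: too_costly_def assigned_cost_split_outliers)
    moreover have "ys \<noteq> []" "set ys \<subseteq> P"
      using set_pmf_d2_sample[OF P_points ys_cheap(1)] False enough_draws dk_ge_1 by auto
    ultimately show ?thesis
      using is_coreset_closest[OF dk_ge_1 P_points z_nonneg tau_closest, of ys 240] by simp
  qed
  then have "measure_pmf.prob (d2_sample d P m) {ys. \<not> too_costly (set ys)}
      \<le> measure_pmf.prob (d2_sample d P m) {ys. ?coreset ys}"
    by (intro measure_pmf.finite_measure_mono_AE) (auto simp: AE_measure_pmf_iff)
  moreover have "32 * card (split_outliers ` P) \<le> m"
    using enough_draws card_split_outliers by (meson mult_le_mono2 order_trans)
  ultimately have "15 / 31 \<le> measure_pmf.prob (d2_sample d P m) {ys. ?coreset ys}"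
    using prob_d2_sample_not_too_costly by (blast intro: order_trans)
  then show ?thesis
    by (simp add: kmeanspp_def vimage_def)
qed

section \<open>Coresets from representative samples\<close>

lemma sum_sqdist_le_by_sample:
  assumes fin_D: "finite D" "D \<noteq> {}" and "0 < q"
    and T_represents: "q * real (card A) \<le> real (card T)"
  shows "sum_sqdist d A D \<le>
    4 * sum_sqdist d A {c} + (4 * sum_sqdist d T {c} + 2 * sum_sqdist d T D) / q"
proof (cases "card A = 0")
  case True
  then have "sum_sqdist d A D = 0" "sum_sqdist d A {c} = 0"
    by (auto simp: sum_sqdist_def card_eq_0_iff)
  then show ?thesis
    using \<open>0 < q\<close> by simp
next
  case False
  define W where "W = 4 * sum_sqdist d T {c} + 2 * sum_sqdist d T D"
  have "0 < q * real (card A)"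
    using False \<open>0 < q\<close> by simp
  then have card_T: "0 < real (card T)"
    using T_represents by linarith
  have "sqdist_to d x D \<le> 4 * sqdist d x c + W / real (card T)" for x
  proof -
    have "real (card T) * sqdist_to d x D
        \<le> (\<Sum>s\<in>T. 4 * sqdist d x c + (4 * sqdist d s c + 2 * sqdist_to d s D))"
      using sqdist_to_relay[OF fin_D] by (intro sum_bounded_below) (simp add: add.assoc)
    also have "\<dots> = real (card T) * (4 * sqdist d x c) + W"
      by (simp add: W_def sum_sqdist_def sum.distrib sum_distrib_left)
    finally show ?thesis
      using card_T by (simp add: field_simps)
  qed
  then have "sum_sqdist d A D \<le> (\<Sum>x\<in>A. 4 * sqdist d x c + W / real (card T))"
    unfolding sum_sqdist_def by (intro sum_mono)
  also have "\<dots> = 4 * sum_sqdist d A {c} + real (card A) / real (card T) * W"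
    by (simp add: sum_sqdist_def sum.distrib sum_distrib_left)
  also have "real (card A) / real (card T) * W \<le> 1 / q * W"
    using T_represents card_T \<open>0 < q\<close> by (intro mult_right_mono) (simp_all add: field_simps W_def)
  finally show ?thesis
    by (simp add: W_def)
qed

context outlier_clustering
begin

definition large :: "point set" where
  "large = {j \<in> C. z \<le> real k * real (card (cluster g Q j))}"

lemma finite_large [simp]: "finite large"
  using finite_C by (simp add: large_def)

lemma card_in_small_clusters: "real (card (Q \<inter> g -` (C - large))) \<le> z"
proof -
  have "real (card (Q \<inter> g -` (C - large))) = (\<Sum>j\<in>C - large. real (card (cluster g Q j)))"
    using finite_C finite_Q by (simp add: sum_card_clusters)
  also have "\<dots> \<le> (\<Sum>j\<in>C - large. z / real k)"
    using k_ge_1 by (intro sum_mono) (auto simp: large_def field_simps)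
  also have "\<dots> \<le> (\<Sum>j\<in>C. z / real k)"
    using finite_C card_outliers by (intro sum_mono2) auto
  also have "\<dots> = z"
    using centers k_ge_1 by (simp add: centers_def)
  finally show ?thesis .
qed

end

locale representative_sample = outlier_clustering +
  fixes p :: real and S :: "point set"
  assumes p_pos: "0 < p" and sample: "S \<subseteq> X"
    and few_outliers: "real (card (S - Q)) \<le> 2.5 * p * z"
    and low_cost: "assigned_cost d g (S \<inter> Q) \<le> 4 * p * assigned_cost d g Q"
    and large_represented: "\<And>j. j \<in> large \<Longrightarrow>
      p / 4 * real (card (cluster g Q j)) \<le> real (card (cluster g (S \<inter> Q) j))"
begin

lemma finite_S: "finite S"
  using sample finite_X by (rule finite_subset)

lemma Opt_sample_le: "Opt d (mset_set S) k (2.5 * p * z) \<le> 4 * p * assigned_cost d g Q"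
proof -
  have "Opt d (mset_set S) k (2.5 * p * z) \<le> cost d (mset_set S) (2.5 * p * z) C"
    by (rule Opt_le[OF centers])
  also have "\<dots> \<le> sum_sqdist d (S \<inter> Q) C"
    using few_outliers
    by (intro cost_mset_set_le finite_C C_nonempty finite_S) (auto simp: Diff_Int)
  also have "\<dots> \<le> assigned_cost d g (S \<inter> Q)"
    unfolding sum_sqdist_def assigned_cost_def by (intro sum_mono sqdist_to_le finite_C g_in)
  finally show ?thesis
    using low_cost by simp
qed

definition served :: "point set \<Rightarrow> point set" where
  "served R = {j \<in> large. p / 8 * real (card (cluster g Q j)) \<le> real (card (cluster g (R \<inter> Q) j))}"

lemma finite_served [simp]: "finite (served R)"
  by (simp add: served_def)

lemma card_in_unserved_clusters:
  assumes "R \<subseteq> S"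
  shows "real (card (Q \<inter> g -` (large - served R))) \<le> 8 / p * real (card (S - R))"
proof -
  have "real (card (cluster g Q j)) \<le> 8 / p * real (card (cluster g ((S - R) \<inter> Q) j))"
    if j_unserved: "j \<in> large - served R" for j
  proof -
    have "cluster g (S \<inter> Q) j = cluster g (R \<inter> Q) j \<union> cluster g ((S - R) \<inter> Q) j"
      using assms by (auto simp: cluster_def)
    then have "card (cluster g (S \<inter> Q) j)
        \<le> card (cluster g (R \<inter> Q) j) + card (cluster g ((S - R) \<inter> Q) j)"
      by (simp add: card_Un_le)
    then have "p / 8 * real (card (cluster g Q j)) \<le> real (card (cluster g ((S - R) \<inter> Q) j))"
      using large_represented[of j] j_unserved by (auto simp: served_def)
    then show ?thesis
      using p_pos by (simp add: field_simps)
  qed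
  then have "(\<Sum>j\<in>large - served R. real (card (cluster g Q j)))
      \<le> (\<Sum>j\<in>large - served R. 8 / p * real (card (cluster g ((S - R) \<inter> Q) j)))"
    by (rule sum_mono)
  then have "real (card (Q \<inter> g -` (large - served R)))
      \<le> 8 / p * real (card ((S - R) \<inter> Q \<inter> g -` (large - served R)))"
    using finite_Q finite_S
    by (simp add: sum_card_clusters flip: sum_distrib_left sum_divide_distrib)
  also have "\<dots> \<le> 8 / p * real (card (S - R))"
    using p_pos finite_S by (intro mult_left_mono) (auto intro!: card_mono)
  finally show ?thesis .
qed

lemma card_unserved:
  assumes "R \<subseteq> S"
  shows "real (card (X - Q \<inter> g -` served R)) \<le> 2 * z + 8 / p * real (card (S - R))"
proof -
  let ?small = "Q \<inter> g -` (C - large)" and ?unserved = "Q \<inter> g -` (large - served R)"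
  have "card (X - Q \<inter> g -` served R) \<le> card ((X - Q) \<union> (?small \<union> ?unserved))"
    using finite_X finite_Q g_in by (intro card_mono) (auto simp: served_def)
  also have "\<dots> \<le> card (X - Q) + (card ?small + card ?unserved)"
    by (meson card_Un_le add_left_mono order_trans)
  finally show ?thesis
    using card_outliers card_in_small_clusters card_in_unserved_clusters[OF assms] by linarith
qed

lemma sum_sqdist_served_le:
  assumes R_subset: "R \<subseteq> S" and fin_D: "finite D" "D \<noteq> {}"
  shows "sum_sqdist d (Q \<inter> g -` served R) D \<le>
    4 * assigned_cost d g Q + 8 / p * (4 * assigned_cost d g (S \<inter> Q) + 2 * sum_sqdist d R D)"
proof -
  have fin: "finite Q" "finite R"
    using finite_Q R_subset finite_S finite_subset by blast+
  let ?T = "\<lambda>j. cluster g (R \<inter> Q) j"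
  have "sum_sqdist d (Q \<inter> g -` served R) D = (\<Sum>j\<in>served R. sum_sqdist d (cluster g Q j) D)"
    using fin by (simp add: sum_sqdist_clusters)
  also have "\<dots> \<le> (\<Sum>j\<in>served R. 4 * sum_sqdist d (cluster g Q j) {j}
      + (4 * sum_sqdist d (?T j) {j} + 2 * sum_sqdist d (?T j) D) / (p / 8))"
    using fin p_pos by (intro sum_mono sum_sqdist_le_by_sample fin_D) (auto simp: served_def)
  also have "\<dots> = 4 * assigned_cost d g (Q \<inter> g -` served R)
      + (4 * assigned_cost d g (R \<inter> Q \<inter> g -` served R)
          + 2 * sum_sqdist d (R \<inter> Q \<inter> g -` served R) D) / (p / 8)"
    using fin by (simp add: sum.distrib sum_sqdist_own_clusters sum_sqdist_clusters
        flip: sum_distrib_left sum_divide_distrib)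
  also have "\<dots> \<le> 4 * assigned_cost d g Q
      + (4 * assigned_cost d g (S \<inter> Q) + 2 * sum_sqdist d R D) / (p / 8)"
    using fin finite_S R_subset p_pos
    by (intro add_mono mult_left_mono divide_right_mono assigned_cost_mono sum_sqdist_mono) auto
  finally show ?thesis
    by (simp add: field_simps)
qed

lemma cost_le_sample_cost:
  assumes fin_D: "finite D" "D \<noteq> {}" and "0 \<le> y"
  shows "cost d (mset_set X) (2 * z + 8 / p * y) D \<le>
    132 * assigned_cost d g Q + 16 / p * cost d (mset_set S) y D"
proof -
  obtain R where R_attains: "R \<subseteq> S" "real (card (S - R)) \<le> y"
    "cost d (mset_set S) y D = sum_sqdist d R D"
    using cost_mset_set_attained[OF finite_S \<open>0 \<le> y\<close>] .
  have "8 / p * real (card (S - R)) \<le> 8 / p * y"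
    using R_attains(2) p_pos by (intro mult_left_mono) auto
  then have "real (card (X - Q \<inter> g -` served R)) \<le> 2 * z + 8 / p * y"
    using card_unserved[OF R_attains(1)] by linarith
  then have "cost d (mset_set X) (2 * z + 8 / p * y) D \<le> sum_sqdist d (Q \<inter> g -` served R) D"
    using inliers by (intro cost_mset_set_le fin_D finite_X) auto
  also have "\<dots> \<le> 4 * assigned_cost d g Q
      + 8 / p * (4 * assigned_cost d g (S \<inter> Q) + 2 * sum_sqdist d R D)"
    by (rule sum_sqdist_served_le[OF R_attains(1) fin_D])
  also have "\<dots> \<le> 4 * assigned_cost d g Q
      + 8 / p * (4 * (4 * p * assigned_cost d g Q) + 2 * sum_sqdist d R D)"
    using low_cost p_pos by (intro add_left_mono mult_left_mono add_right_mono) auto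
  also have "\<dots> = 132 * assigned_cost d g Q + 16 / p * cost d (mset_set S) y D"
    using p_pos by (simp add: R_attains(3) field_simps)
  finally show ?thesis .
qed

lemma is_coreset_sample:
  assumes near_opt: "assigned_cost d g Q \<le> B * Opt d (mset_set X) k z"
  shows "is_coreset d k 22 (196 * B) (mset_set S) (2.5 * p * z) (mset_set X) z"
  unfolding is_coreset_def
proof (intro ballI allI impI)
  fix D and \<kappa>\<^sub>1 \<kappa>\<^sub>2 :: real
  define r where "r = assigned_cost d g Q"
  let ?y = "\<kappa>\<^sub>1 * (2.5 * p * z)"
  assume D_centers: "D \<in> centers d k" and factors_ge_1: "1 \<le> \<kappa>\<^sub>1" "1 \<le> \<kappa>\<^sub>2"
    and S_approx: "cost d (mset_set S) ?y D \<le> \<kappa>\<^sub>2 * Opt d (mset_set S) k (2.5 * p * z)"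
  note fin_D = centersD[OF D_centers k_ge_1]
  note S_approx
  also have "\<kappa>\<^sub>2 * Opt d (mset_set S) k (2.5 * p * z) \<le> \<kappa>\<^sub>2 * (4 * p * r)"
    unfolding r_def using factors_ge_1 by (intro mult_left_mono Opt_sample_le) auto
  finally have cost_S: "16 / p * cost d (mset_set S) ?y D \<le> 16 / p * (\<kappa>\<^sub>2 * (4 * p * r))"
    using p_pos by (intro mult_left_mono) auto
  have z_nonneg: "0 \<le> z"
    using card_outliers by linarith
  have "2 * z + 8 / p * ?y \<le> 22 * \<kappa>\<^sub>1 * z"
    using p_pos mult_right_mono[OF factors_ge_1(1) z_nonneg] by (simp add: algebra_simps)
  moreover have "0 \<le> ?y"
    using factors_ge_1 p_pos z_nonneg by simp
  ultimately have "cost d (mset_set X) (22 * \<kappa>\<^sub>1 * z) D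
      \<le> cost d (mset_set X) (2 * z + 8 / p * ?y) D"
    using fin_D z_nonneg p_pos by (intro cost_antimono) auto
  also have "\<dots> \<le> 132 * r + 16 / p * (\<kappa>\<^sub>2 * (4 * p * r))"
    using cost_le_sample_cost[OF fin_D \<open>0 \<le> ?y\<close>] cost_S unfolding r_def by linarith
  also have "\<dots> = 132 * r + 64 * (\<kappa>\<^sub>2 * r)"
    using p_pos by (simp add: field_simps)
  also have "\<dots> \<le> 196 * \<kappa>\<^sub>2 * r"
    using mult_right_mono[OF factors_ge_1(2), of r] by (simp add: r_def)
  also have "\<dots> \<le> 196 * \<kappa>\<^sub>2 * (B * Opt d (mset_set X) k z)"
    using near_opt factors_ge_1 by (intro mult_left_mono) (auto simp: r_def)
  finally show "cost d (mset_set X) (22 * \<kappa>\<^sub>1 * z) D \<le> 196 * B * \<kappa>\<^sub>2 * Opt d (mset_set X) k z"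
    by (simp add: mult_ac)
qed

end

section \<open>Uniform sampling\<close>

lemma prob_gt_multiple_expectation_le:
  fixes f :: "'a \<Rightarrow> real"
  assumes "integrable (measure_pmf M) f" "\<And>x. 0 \<le> f x" "0 < t"
  shows "measure_pmf.prob M {x. t * measure_pmf.expectation M f < f x} \<le> 1 / t"
proof (cases "measure_pmf.expectation M f = 0")
  case True
  then have "AE x in M. f x = 0"
    using integral_nonneg_eq_0_iff_AE[OF assms(1)] assms(2) by simp
  then have "measure_pmf.prob M {x. 0 < f x} = 0"
    by (subst measure_pmf.prob_eq_0) (auto elim: eventually_mono)
  then show ?thesis
    using True assms(3) by simp
next
  case False
  moreover have "0 \<le> measure_pmf.expectation M f"
    using assms(2) by simp
  ultimately have pos: "0 < t * measure_pmf.expectation M f"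
    using assms(3) by simp
  have "measure_pmf.prob M {x. t * measure_pmf.expectation M f < f x}
      \<le> measure_pmf.prob M {x. t * measure_pmf.expectation M f \<le> f x}"
    by (intro measure_pmf.finite_measure_mono) auto
  also have "\<dots> \<le> 1 / t"
    using integral_Markov_inequality_measure[OF assms(1), of "{}" "t * measure_pmf.expectation M f"]
      pos assms(2) False by simp
  finally show ?thesis .
qed

lemma set_pmf_subsample: "set_pmf (subsample X p) \<subseteq> Pow X"
  by (auto simp: subsample_def)

lemma integrable_subsample:
  fixes f :: "point set \<Rightarrow> real"
  assumes "finite X"
  shows "integrable (measure_pmf (subsample X p)) f"
  using finite_subset[OF set_pmf_subsample] assms by (intro integrable_measure_pmf_finite) auto

lemma prob_mem_subsample:
  assumes "finite X" "x \<in> X" "0 \<le> p" "p \<le> 1"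
  shows "measure_pmf.prob (subsample X p) {S. x \<in> S} = p"
proof -
  have "measure_pmf.prob (subsample X p) {S. x \<in> S}
      = measure_pmf.prob (map_pmf (\<lambda>b. b x) (Pi_pmf X False (\<lambda>_. bernoulli_pmf p))) {True}"
    using assms(2) by (simp add: subsample_def vimage_def)
  also have "\<dots> = p"
    using assms by (simp add: Pi_pmf_component measure_pmf_single)
  finally show ?thesis .
qed

lemma expectation_subsample_sum:
  fixes h :: "point \<Rightarrow> real"
  assumes "finite X" "A \<subseteq> X" "0 \<le> p" "p \<le> 1"
  shows "measure_pmf.expectation (subsample X p) (\<lambda>S. \<Sum>x\<in>S \<inter> A. h x) = p * (\<Sum>x\<in>A. h x)"
proof -
  have "finite A"
    using assms finite_subset by auto
  then have "measure_pmf.expectation (subsample X p) (\<lambda>S. \<Sum>x\<in>S \<inter> A. h x)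
     = measure_pmf.expectation (subsample X p) (\<lambda>S. \<Sum>x\<in>A. h x * indicator {S. x \<in> S} S)"
    by (intro Bochner_Integration.integral_cong refl sum.mono_neutral_cong_left)
      (auto simp: indicator_def)
  also have "\<dots> = (\<Sum>x\<in>A. measure_pmf.expectation (subsample X p) (\<lambda>S. h x * indicator {S. x \<in> S} S))"
    using assms by (intro Bochner_Integration.integral_sum integrable_subsample)
  also have "\<dots> = (\<Sum>x\<in>A. h x * p)"
    using assms by (intro sum.cong) (auto simp: prob_mem_subsample)
  finally show ?thesis
    by (simp add: sum_distrib_left mult.commute)
qed

lemma prob_subsample_sum_gt:
  fixes h :: "point \<Rightarrow> real"
  assumes "finite X" "A \<subseteq> X" "0 \<le> p" "p \<le> 1" "\<And>x. 0 \<le> h x" "0 < t"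
  shows "measure_pmf.prob (subsample X p) {S. t * (p * (\<Sum>x\<in>A. h x)) < (\<Sum>x\<in>S \<inter> A. h x)} \<le> 1 / t"
  using prob_gt_multiple_expectation_le[OF integrable_subsample[OF assms(1)],
      of "\<lambda>S. \<Sum>x\<in>S \<inter> A. h x" t p]
    assms by (simp add: expectation_subsample_sum sum_nonneg)

lemma expectation_subsample_power_card:
  assumes "finite X" "A \<subseteq> X" "0 \<le> p" "p \<le> 1" "0 \<le> q"
  shows "measure_pmf.expectation (subsample X p) (\<lambda>S. q ^ card (S \<inter> A)) = (1 - p * (1 - q)) ^ card A"
proof -
  let ?w = "\<lambda>x v. if x \<in> A \<and> v then q else 1"
  have "q ^ card ({x \<in> X. b x} \<inter> A) = (\<Prod>x\<in>X. ?w x (b x))" for b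
  proof -
    have "{x \<in> X. b x} \<inter> A = {x \<in> X. x \<in> A \<and> b x}"
      by auto
    then show ?thesis
      using assms(1) by (simp add: prod.If_cases Int_def)
  qed
  then have "measure_pmf.expectation (subsample X p) (\<lambda>S. q ^ card (S \<inter> A))
      = measure_pmf.expectation (Pi_pmf X False (\<lambda>_. bernoulli_pmf p)) (\<lambda>b. \<Prod>x\<in>X. ?w x (b x))"
    by (simp add: subsample_def)
  also have "\<dots> = (\<Prod>x\<in>X. measure_pmf.expectation (bernoulli_pmf p) (?w x))"
    using assms by (intro expectation_prod_Pi_pmf[where f = ?w] integrable_measure_pmf_finite) auto
  also have "\<dots> = (\<Prod>x\<in>X. if x \<in> A then 1 - p * (1 - q) else 1)"
    using assms by (intro prod.cong) (auto simp: algebra_simps)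
  also have "\<dots> = (1 - p * (1 - q)) ^ card A"
    using assms by (simp add: prod.If_cases Int_absorb1 Int_def[symmetric])
  finally show ?thesis .
qed

lemma prob_subsample_card_lt:
  assumes "finite X" "A \<subseteq> X" "0 \<le> p" "p \<le> 1"
  shows "measure_pmf.prob (subsample X p) {S. real (card (S \<inter> A)) < p / 4 * real (card A)}
    \<le> exp (- (p / 4 * real (card A)))"
proof -
  let ?M = "subsample X p"
  define a where "a = p / 4 * real (card A)"
  define f :: "point set \<Rightarrow> real" where "f S = (1 / 2) ^ card (S \<inter> A)" for S
  have f_nonneg: "0 \<le> f S" for S
    by (simp add: f_def)
  have "exp (-1) \<le> (1 / 2 :: real)"
    using exp_ge_add_one_self[of 1] by (simp add: exp_minus field_simps)
  have "exp (- a) \<le> f S" if "real (card (S \<inter> A)) < a" for S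
  proof -
    have "exp (- a) \<le> exp (- real (card (S \<inter> A)))"
      using that by simp
    also have "\<dots> = exp (-1) ^ card (S \<inter> A)"
      by (simp flip: exp_of_nat_mult)
    also have "\<dots> \<le> f S"
      unfolding f_def using \<open>exp (-1) \<le> 1 / 2\<close> by (intro power_mono) auto
    finally show ?thesis .
  qed
  then have "measure_pmf.prob ?M {S. real (card (S \<inter> A)) < a}
      \<le> measure_pmf.prob ?M {S. exp (- a) \<le> f S}"
    by (intro measure_pmf.finite_measure_mono) auto
  also have "\<dots> \<le> measure_pmf.expectation ?M f / exp (- a)"
    using integral_Markov_inequality_measure[OF integrable_subsample[OF assms(1)],
        of "{}" p f "exp (- a)"] f_nonneg
    by simp
  also have "measure_pmf.expectation ?M f = (1 - p / 2) ^ card A"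
    unfolding f_def using assms by (subst expectation_subsample_power_card) auto
  also have "\<dots> \<le> exp (- (p / 2)) ^ card A"
    using assms exp_ge_add_one_self[of "- (p / 2)"] by (intro power_mono) auto
  also have "\<dots> = exp (- (2 * a))"
    by (simp add: a_def mult_ac flip: exp_of_nat_mult)
  finally show ?thesis
    by (simp add: a_def divide_right_mono flip: exp_diff)
qed

context outlier_clustering
begin

lemma prob_many_outliers:
  assumes "0 \<le> p" "p \<le> 1"
  shows "measure_pmf.prob (subsample X p) {S. 2.5 * p * z < real (card (S - Q))} \<le> 2 / 5"
proof -
  have "p * real (card (X - Q)) \<le> p * z"
    using card_outliers assms by (intro mult_left_mono)
  then have "2.5 * (p * real (card (X - Q))) < real (card (S \<inter> (X - Q)))"
    if "S \<in> set_pmf (subsample X p)" "2.5 * p * z < real (card (S - Q))" for S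
  proof -
    have "S \<inter> (X - Q) = S - Q"
      using that(1) set_pmf_subsample by blast
    then show ?thesis
      using that(2) \<open>p * real (card (X - Q)) \<le> p * z\<close> by simp
  qed
  then have "measure_pmf.prob (subsample X p) {S. 2.5 * p * z < real (card (S - Q))}
      \<le> measure_pmf.prob (subsample X p) {S. 2.5 * (p * (\<Sum>x\<in>X - Q. 1)) < (\<Sum>x\<in>S \<inter> (X - Q). 1)}"
    by (intro measure_pmf.finite_measure_mono_AE) (auto simp: AE_measure_pmf_iff)
  also have "\<dots> \<le> 1 / 2.5"
    using assms by (intro prob_subsample_sum_gt finite_X) auto
  finally show ?thesis
    by simp
qed

lemma prob_high_cost:
  assumes "0 \<le> p" "p \<le> 1"
  shows "measure_pmf.prob (subsample X p)
    {S. 4 * p * assigned_cost d g Q < assigned_cost d g (S \<inter> Q)} \<le> 1 / 4"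
  using prob_subsample_sum_gt[OF finite_X inliers assms, of "\<lambda>x. sqdist d x (g x)" 4]
  by (simp add: assigned_cost_def mult.assoc)

lemma prob_large_unrepresented:
  assumes p_bounds: "0 \<le> p" "p \<le> 1" and pz_ge: "4 * real k * ln (8 * real k) \<le> p * z"
    and j_large: "j \<in> large"
  shows "measure_pmf.prob (subsample X p)
    {S. real (card (cluster g (S \<inter> Q) j)) < p / 4 * real (card (cluster g Q j))} \<le> 1 / (8 * real k)"
proof -
  have "real k * (4 * ln (8 * real k)) \<le> p * z"
    using pz_ge by (simp add: mult_ac)
  also have "\<dots> \<le> p * (real k * real (card (cluster g Q j)))"
    using j_large p_bounds by (intro mult_left_mono) (auto simp: large_def)
  also have "\<dots> = real k * (p * real (card (cluster g Q j)))"
    by simp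
  finally have log_le: "ln (8 * real k) \<le> p / 4 * real (card (cluster g Q j))"
    using k_ge_1 by (simp add: mult_le_cancel_left)
  have "cluster g Q j \<subseteq> X"
    using inliers by (auto simp: cluster_def)
  moreover have "cluster g (S \<inter> Q) j = S \<inter> cluster g Q j" for S
    by (auto simp: cluster_def)
  ultimately have "measure_pmf.prob (subsample X p)
      {S. real (card (cluster g (S \<inter> Q) j)) < p / 4 * real (card (cluster g Q j))}
      \<le> exp (- (p / 4 * real (card (cluster g Q j))))"
    using prob_subsample_card_lt[OF finite_X _ p_bounds, of "cluster g Q j"] by simp
  also have "\<dots> \<le> exp (- ln (8 * real k))"
    using log_le by simp
  also have "\<dots> = 1 / (8 * real k)"
    using k_ge_1 by (simp add: exp_minus field_simps)
  finally show ?thesis .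
qed

lemma prob_representative_sample:
  assumes p_bounds: "0 < p" "p \<le> 1" and pz_ge: "4 * real k * ln (8 * real k) \<le> p * z"
  shows "9 / 40 \<le> measure_pmf.prob (subsample X p) {S. representative_sample d k X z C Q g p S}"
proof -
  let ?M = "subsample X p"
  define many where "many = {S. 2.5 * p * z < real (card (S - Q))}"
  define high where "high = {S. 4 * p * assigned_cost d g Q < assigned_cost d g (S \<inter> Q)}"
  define unrep where
    "unrep j = {S. real (card (cluster g (S \<inter> Q) j)) < p / 4 * real (card (cluster g Q j))}" for j
  define bad where "bad = many \<union> (high \<union> (\<Union>j\<in>large. unrep j))"
  have "measure_pmf.prob ?M (\<Union>j\<in>large. unrep j) \<le> (\<Sum>j\<in>large. measure_pmf.prob ?M (unrep j))"
    by (intro measure_pmf.finite_measure_subadditive_finite) auto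
  also have "\<dots> \<le> (\<Sum>j\<in>large. 1 / (8 * real k))"
    unfolding unrep_def using p_bounds pz_ge by (intro sum_mono prob_large_unrepresented) auto
  also have "\<dots> \<le> (\<Sum>j\<in>C. 1 / (8 * real k))"
    using finite_C by (intro sum_mono2) (auto simp: large_def)
  also have "\<dots> = 1 / 8"
    using centers k_ge_1 by (simp add: centers_def)
  finally have "measure_pmf.prob ?M (\<Union>j\<in>large. unrep j) \<le> 1 / 8" .
  moreover have "measure_pmf.prob ?M bad
      \<le> measure_pmf.prob ?M many
        + (measure_pmf.prob ?M high + measure_pmf.prob ?M (\<Union>j\<in>large. unrep j))"
    unfolding bad_def by (intro order_trans[OF measure_Un_le] add_left_mono) auto
  moreover have "measure_pmf.prob ?M many \<le> 2 / 5" "measure_pmf.prob ?M high \<le> 1 / 4"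
    unfolding many_def high_def using p_bounds prob_many_outliers[of p] prob_high_cost[of p]
    by simp_all
  ultimately have "9 / 40 \<le> measure_pmf.prob ?M (UNIV - bad)"
    using measure_pmf.prob_compl[of bad ?M] by simp
  also have "\<dots> \<le> measure_pmf.prob ?M {S. representative_sample d k X z C Q g p S}"
  proof (rule measure_pmf.finite_measure_mono_AE)
    have "representative_sample d k X z C Q g p S" if "S \<in> set_pmf ?M" "S \<notin> bad" for S
      using that set_pmf_subsample[of X p] p_bounds
      by unfold_locales (auto simp: bad_def many_def high_def unrep_def not_less)
    then show "AE S in ?M. S \<in> UNIV - bad \<longrightarrow> S \<in> {S. representative_sample d k X z C Q g p S}"
      by (auto simp: AE_measure_pmf_iff)
  qed simp
  finally show ?thesis .
qed

end

lemma prob_subsample_coreset: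
  assumes "1 \<le> d" "1 \<le> k" "finite X" "X \<subseteq> topspace (Euclidean_space d)" "0 \<le> z"
    and "0 < p" "p \<le> 1" "4 * real k * ln (8 * real k) \<le> p * z"
  shows "9 / 40 \<le> measure_pmf.prob (subsample X p)
    {S. is_coreset d k 22 784 (mset_set S) (2.5 * p * z) (mset_set X) z}"
proof -
  obtain C Q g where outlier: "outlier_clustering d k X z C Q g"
    and near_opt: "assigned_cost d g Q \<le> 4 * Opt d (mset_set X) k z"
    using near_optimal_clustering[OF assms(1-5)] .
  have "9 / 40 \<le> measure_pmf.prob (subsample X p) {S. representative_sample d k X z C Q g p S}"
    using outlier assms(6-8) by (rule outlier_clustering.prob_representative_sample)
  also have "\<dots> \<le> measure_pmf.prob (subsample X p)
      {S. is_coreset d k 22 784 (mset_set S) (2.5 * p * z) (mset_set X) z}"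
    using representative_sample.is_coreset_sample[OF _ near_opt]
    by (intro measure_pmf.finite_measure_mono) auto
  finally show ?thesis .
qed

section \<open>The two-stage sampling algorithm\<close>

lemma ln_le_mult_ln: "\<lbrakk>0 < x; 0 < y; x \<le> y ^ r\<rbrakk> \<Longrightarrow> ln x \<le> real r * ln y" for x y :: real
  by (metis ln_mono ln_realpow zero_less_power)

lemma le_two_mult_ln:
  assumes "2 \<le> n"
  shows "real k \<le> 2 * (real k * ln (real n))"
proof -
  have "1 / 2 \<le> ln (2::real)"
    using ln2_ge_two_thirds by simp
  also have "\<dots> \<le> ln (real n)"
    using assms by simp
  finally show ?thesis
    using mult_left_mono[of 1 "2 * ln (real n)" "real k"] by simp
qed

lemma sample_prob_mult:
  assumes "1 \<le> z"
  shows "sample_prob n k z * real z =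
    max (36 * ln (4 * real n * (real k)\<^sup>2 / real z)) (36 * real k * ln (2 * real k ^ 3))"
  using assms by (simp add: sample_prob_def max_mult_distrib_right)

lemma sample_prob_mult_ge:
  assumes "1 \<le> k" "1 \<le> z"
  shows "4 * real k * ln (8 * real k) \<le> sample_prob n k z * real z"
proof -
  have "8 * real k \<le> 8 * real k ^ 9"
    using self_le_power[of "real k" 9] assms by simp
  then have "ln (8 * real k) \<le> 3 * ln (2 * real k ^ 3)"
    using ln_le_mult_ln[of "8 * real k" "2 * real k ^ 3" 3] assms
    by (simp add: power_mult_distrib flip: power_mult)
  moreover have "1 \<le> real k ^ 3"
    using assms by (intro one_le_power) simp
  then have "0 \<le> ln (2 * real k ^ 3)"
    by simp
  ultimately have "4 * real k * ln (8 * real k) \<le> 4 * real k * (9 * ln (2 * real k ^ 3))"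
    by (intro mult_left_mono) auto
  also have "\<dots> \<le> sample_prob n k z * real z"
    by (simp add: sample_prob_mult[OF assms(2)])
  finally show ?thesis .
qed

lemma sample_prob_pos:
  assumes "1 \<le> k" "1 \<le> z"
  shows "0 < sample_prob n k z"
proof -
  have "0 < 4 * real k * ln (8 * real k)"
    using assms by simp
  also have "\<dots> \<le> sample_prob n k z * real z"
    by (rule sample_prob_mult_ge[OF assms])
  finally show ?thesis
    using assms by (simp add: zero_less_mult_iff)
qed

lemma sample_prob_mult_le:
  assumes "1 \<le> k" "1 \<le> z" "k \<le> n" "2 \<le> n"
  shows "sample_prob n k z * real z \<le> 180 * (real k * ln (real n))"
proof -
  have real_bounds: "2 \<le> real n" "1 \<le> real k" "real k \<le> real n" "1 \<le> real z"
    using assms by linarith+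
  then have ln_n: "0 \<le> ln (real n)"
    by simp
  have "4 * real n * (real k)\<^sup>2 / real z \<le> 4 * real n * (real k)\<^sup>2 / 1"
    using real_bounds by (intro divide_left_mono) auto
  also have "\<dots> \<le> (real n)\<^sup>2 * real n * (real n)\<^sup>2"
    unfolding div_by_1 using real_bounds power_mono[of 2 "real n" 2]
    by (intro mult_mono power_mono) auto
  finally have "ln (4 * real n * (real k)\<^sup>2 / real z) \<le> 5 * ln (real n)"
    using ln_le_mult_ln[of "4 * real n * (real k)\<^sup>2 / real z" "real n" 5] real_bounds
    by (simp add: power_numeral_reduce mult_ac)
  also have "\<dots> \<le> 5 * (real k * ln (real n))"
    using real_bounds ln_n mult_right_mono[of 1 "real k" "ln (real n)"] by simp
  finally have first_term: "36 * ln (4 * real n * (real k)\<^sup>2 / real z) \<le> 180 * (real k * ln (real n))"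
    by simp
  have "2 * real k ^ 3 \<le> real n * real n ^ 3"
    using real_bounds by (auto intro!: mult_mono power_mono)
  then have "ln (2 * real k ^ 3) \<le> 4 * ln (real n)"
    using ln_le_mult_ln[of "2 * real k ^ 3" "real n" 4] real_bounds
    by (simp add: power_numeral_reduce)
  also have "\<dots> \<le> 5 * ln (real n)"
    using ln_n by simp
  finally have "ln (2 * real k ^ 3) \<le> 5 * ln (real n)" .
  then have "36 * real k * ln (2 * real k ^ 3) \<le> 36 * real k * (5 * ln (real n))"
    by (intro mult_left_mono) auto
  with first_term show ?thesis
    by (simp add: sample_prob_mult[OF assms(2)])
qed

definition first_stage :: "point set \<Rightarrow> real \<Rightarrow> point set pmf" where
  "first_stage X p = (if p > 1 then return_pmf X else subsample X p)"

definition num_draws :: "nat \<Rightarrow> nat \<Rightarrow> real \<Rightarrow> nat" where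
  "num_draws k z p = (if p > 1 then 32 * (k + z) else nat \<lceil>32 * (real k + 2.5 * p * real z)\<rceil>)"

definition sample_budget :: "nat \<Rightarrow> real \<Rightarrow> real" where
  "sample_budget z p = (if p > 1 then real z else 2.5 * p * real z)"

lemma sample_coreset_eq:
  assumes "p = sample_prob (card X) k z"
  shows "sample_coreset d \<tau> X k z =
    bind_pmf (first_stage X p) (\<lambda>S. kmeanspp d \<tau> S (num_draws k z p))"
  by (simp add: assms sample_coreset_def first_stage_def num_draws_def Let_def bind_return_pmf)

lemma set_pmf_first_stage: "set_pmf (first_stage X p) \<subseteq> Pow X"
  using set_pmf_subsample by (auto simp: first_stage_def)

lemma num_draws_ge:
  assumes "0 \<le> p"
  shows "32 * (k + nat \<lfloor>sample_budget z p\<rfloor>) \<le> num_draws k z p"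
proof (cases "p > 1")
  case True
  then show ?thesis
    by (simp add: num_draws_def sample_budget_def)
next
  case False
  have "real (nat \<lfloor>2.5 * p * real z\<rfloor>) \<le> 2.5 * p * real z"
    using assms by (intro of_nat_floor) simp
  then have "real (32 * (k + nat \<lfloor>2.5 * p * real z\<rfloor>)) \<le> 32 * (real k + 2.5 * p * real z)"
    by simp
  also have "\<dots> \<le> real (nat \<lceil>32 * (real k + 2.5 * p * real z)\<rceil>)"
    by (rule of_nat_ceiling)
  finally show ?thesis
    using False by (simp add: num_draws_def sample_budget_def)
qed

lemma num_draws_le:
  assumes "1 \<le> k" "0 \<le> p"
  shows "real (num_draws k z p) \<le> 33 * real k + 80 * (p * real z)"
proof (cases "p > 1")
  case True
  then have "real z \<le> p * real z"
    using mult_right_mono[of 1 p "real z"] by simp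
  then show ?thesis
    using True by (simp add: num_draws_def)
next
  case False
  have "0 \<le> 32 * (real k + 2.5 * p * real z)"
    using assms by simp
  then have "real (nat \<lceil>32 * (real k + 2.5 * p * real z)\<rceil>) \<le> 32 * (real k + 2.5 * p * real z) + 1"
    by linarith
  then show ?thesis
    using False assms(1) by (simp add: num_draws_def)
qed

lemma set_pmf_kmeanspp:
  assumes "finite P" "P \<subseteq> topspace (Euclidean_space d)" "(Y, w) \<in> set_pmf (kmeanspp d \<tau> P m)"
  shows "Y \<subseteq> P" "card Y \<le> m"
proof -
  obtain ys where "ys \<in> set_pmf (d2_sample d P m)" "Y = set ys"
    using assms(3) by (auto simp: kmeanspp_def)
  then show "Y \<subseteq> P" "card Y \<le> m"
    using set_pmf_d2_sample[OF assms(1,2)] card_length[of ys] by force+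
qed

lemma card_sample_coreset_le:
  assumes X_points: "finite X" "X \<subseteq> topspace (Euclidean_space d)" and n_ge_2: "2 \<le> card X"
    and kz_ge_1: "1 \<le> k" "1 \<le> z" and Yw_output: "(Y, w) \<in> set_pmf (sample_coreset d \<tau> X k z)"
  shows "real (card Y) \<le> 15000 * real k * ln (real (card X))"
proof -
  define p where "p = sample_prob (card X) k z"
  obtain S where S_stage: "S \<in> set_pmf (first_stage X p)"
    "(Y, w) \<in> set_pmf (kmeanspp d \<tau> S (num_draws k z p))"
    using Yw_output unfolding sample_coreset_eq[OF p_def] set_bind_pmf by blast
  have "S \<subseteq> X"
    using S_stage(1) set_pmf_first_stage by blast
  then have "finite S" "S \<subseteq> topspace (Euclidean_space d)"
    using X_points finite_subset by blast+
  note Y_output = set_pmf_kmeanspp[OF this S_stage(2)]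
  note k_le = le_two_mult_ln[OF n_ge_2, of k]
  show ?thesis
  proof (cases "card X \<le> k")
    case True
    moreover have "card Y \<le> card X"
      using X_points(1) Y_output(1) \<open>S \<subseteq> X\<close> by (intro card_mono) auto
    ultimately have "real (card Y) \<le> real k"
      by simp
    then show ?thesis
      using k_le by simp
  next
    case False
    have "real (card Y) \<le> 33 * real k + 80 * (p * real z)"
      using num_draws_le[of k p z] sample_prob_pos[of k z "card X"] kz_ge_1 Y_output(2)
      by (simp add: p_def)
    moreover have "p * real z \<le> 180 * (real k * ln (real (card X)))"
      unfolding p_def using kz_ge_1 n_ge_2 False by (intro sample_prob_mult_le) auto
    ultimately have "real (card Y) \<le> 15000 * (real k * ln (real (card X)))"
      using k_le by linarith
    then show ?thesis
      by simp
  qed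
qed

lemma expectation_card_sample_coreset:
  assumes "finite X" "X \<subseteq> topspace (Euclidean_space d)" "2 \<le> card X" "1 \<le> k" "1 \<le> z"
  shows "measure_pmf.expectation (sample_coreset d \<tau> X k z) (\<lambda>(Y, w). real (card Y))
    \<le> 15000 * real k * ln (real (card X))"
proof (rule measure_pmf.integral_le_const)
  let ?M = "measure_pmf (sample_coreset d \<tau> X k z)" and ?B = "15000 * real k * ln (real (card X))"
  show bounded: "AE Yw in ?M. (case Yw of (Y, w) \<Rightarrow> real (card Y)) \<le> ?B"
    using card_sample_coreset_le[OF assms] by (auto simp: AE_measure_pmf_iff)
  show "integrable ?M (\<lambda>(Y, w). real (card Y))"
    by (rule measure_pmf.integrable_const_bound[where B = ?B])
      (use bounded in \<open>auto simp: case_prod_beta\<close>)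
qed

lemma prob_bind_pmf_ge:
  assumes "a \<le> measure_pmf.prob M G" "0 \<le> b"
    and "\<And>x. \<lbrakk>x \<in> set_pmf M; x \<in> G\<rbrakk> \<Longrightarrow> b \<le> measure_pmf.prob (f x) E"
  shows "a * b \<le> measure_pmf.prob (bind_pmf M f) E"
proof -
  have "ennreal (b * measure_pmf.prob M G) = (\<integral>\<^sup>+x. ennreal b * indicator G x \<partial>measure_pmf M)"
    using assms(2)
    by (simp add: nn_integral_cmult_indicator measure_pmf.emeasure_eq_measure ennreal_mult)
  also have "\<dots> \<le> (\<integral>\<^sup>+x. emeasure (f x) E \<partial>measure_pmf M)"
    using assms(3) by (intro nn_integral_mono_AE)
      (auto simp: AE_measure_pmf_iff measure_pmf.emeasure_eq_measure indicator_def ennreal_leI)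
  also have "\<dots> = ennreal (measure_pmf.prob (bind_pmf M f) E)"
    by (simp flip: measure_pmf.emeasure_eq_measure)
  finally have "b * measure_pmf.prob M G \<le> measure_pmf.prob (bind_pmf M f) E"
    by (simp add: ennreal_le_iff)
  then show ?thesis
    using mult_left_mono[OF assms(1,2)] by (simp add: mult.commute)
qed

lemma prob_first_stage_coreset:
  assumes "1 \<le> d" "1 \<le> k" "finite X" "X \<subseteq> topspace (Euclidean_space d)" "1 \<le> z"
    and p_eq: "p = sample_prob n k z"
  shows "9 / 40 \<le> measure_pmf.prob (first_stage X p)
    {S. is_coreset d k 22 784 (mset_set S) (sample_budget z p) (mset_set X) (real z)}"
proof (cases "p > 1")
  case True
  have "is_coreset d k 22 784 (mset_set X) (real z) (mset_set X) (real z)"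
    using is_coreset_mono[OF is_coreset_refl] assms by simp
  then show ?thesis
    using True by (simp add: first_stage_def sample_budget_def)
next
  case False
  then show ?thesis
    using assms prob_subsample_coreset[of d k X "real z" p]
    by (simp add: first_stage_def sample_budget_def sample_prob_pos sample_prob_mult_ge)
qed

lemma prob_sample_coreset:
  assumes dk_ge_1: "1 \<le> d" "1 \<le> k" and X_points: "finite X" "X \<subseteq> topspace (Euclidean_space d)"
    and z_ge_1: "1 \<le> z"
    and tau_closest: "closest_rule d \<tau>" and p_eq: "p = sample_prob (card X) k z"
  shows "1 / 10 \<le> measure_pmf.prob (sample_coreset d \<tau> X k z)
    {(Y, w). is_coreset d k 22 (1444 * 784)
      (weighted_mset Y w) (sample_budget z p) (mset_set X) (real z)}"
    (is "_ \<le> measure_pmf.prob _ ?coreset")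
proof -
  have "0 \<le> p"
    using sample_prob_pos[OF dk_ge_1(2) z_ge_1] by (simp add: p_eq less_imp_le)
  have "9 / 40 * (15 / 31) \<le>
    measure_pmf.prob (bind_pmf (first_stage X p) (\<lambda>S. kmeanspp d \<tau> S (num_draws k z p))) ?coreset"
  proof (rule prob_bind_pmf_ge[OF prob_first_stage_coreset[OF dk_ge_1 X_points z_ge_1 p_eq]])
    fix S assume S_good: "S \<in> set_pmf (first_stage X p)"
      "S \<in> {S. is_coreset d k 22 784 (mset_set S) (sample_budget z p) (mset_set X) (real z)}"
    have "S \<subseteq> X"
      using S_good(1) set_pmf_first_stage[of X p] by auto
    then have "finite S" "S \<subseteq> topspace (Euclidean_space d)"
      using X_points finite_subset by auto
    moreover have "0 \<le> sample_budget z p"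
      using \<open>0 \<le> p\<close> by (simp add: sample_budget_def)
    ultimately have "15 / 31 \<le> measure_pmf.prob (kmeanspp d \<tau> S (num_draws k z p))
      {(Y, w). is_coreset d k 1 1444
        (weighted_mset Y w) (sample_budget z p) (mset_set S) (sample_budget z p)}"
      using \<open>0 \<le> p\<close> by (intro prob_kmeanspp_coreset dk_ge_1 num_draws_ge tau_closest)
    also have "\<dots> \<le> measure_pmf.prob (kmeanspp d \<tau> S (num_draws k z p)) ?coreset"
      using S_good(2) is_coreset_trans[of d k 1 1444 _
          "sample_budget z p" "mset_set S" "sample_budget z p" 22 784]
      by (intro measure_pmf.finite_measure_mono) auto
    finally show "15 / 31 \<le> measure_pmf.prob (kmeanspp d \<tau> S (num_draws k z p)) ?coreset" .
  qed simp
  then show ?thesis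
    by (simp add: sample_coreset_eq[OF p_eq])
qed

theorem theorem4:
  "\<exists>\<alpha> \<beta> c K :: real. \<alpha> > 0 \<and> \<beta> > 0 \<and> c > 0 \<and> K > 0 \<and>
     (\<forall>(d::nat) (X::point set) (k::nat) (z::nat) \<tau>.
        d \<ge> 1 \<and> X \<subseteq> topspace (Euclidean_space d) \<and> finite X \<and> X \<noteq> {} \<and>
        k \<ge> 1 \<and> z \<ge> 1 \<and> closest_rule d \<tau> \<longrightarrow>
        (let n = card X;
             p = sample_prob n k z;
             z' = (if p > 1 then real z else 2.5 * p * real z);
             A = sample_coreset d \<tau> X k z
         in measure_pmf.prob A
              {(Y, w). is_coreset d k \<alpha> \<beta> (weighted_mset Y w) z' (mset_set X) (real z)} \<ge> c \<and>
            (n \<ge> 2 \<longrightarrow>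
              measure_pmf.expectation A (\<lambda>(Y, w). real (card Y)) \<le> K * real k * ln (real n))))"
proof (intro exI conjI allI impI)
  fix d k z :: nat and X :: "point set" and \<tau>
  assume "d \<ge> 1 \<and> X \<subseteq> topspace (Euclidean_space d) \<and> finite X \<and> X \<noteq> {} \<and>
    k \<ge> 1 \<and> z \<ge> 1 \<and> closest_rule d \<tau>"
  then show "let n = card X;
             p = sample_prob n k z;
             z' = (if p > 1 then real z else 2.5 * p * real z);
             A = sample_coreset d \<tau> X k z
         in measure_pmf.prob A
              {(Y, w). is_coreset d k 22 (1444 * 784) (weighted_mset Y w) z' (mset_set X) (real z)} \<ge> 1 / 10 \<and>
            (n \<ge> 2 \<longrightarrow>
              measure_pmf.expectation A (\<lambda>(Y, w). real (card Y)) \<le> 15000 * real k * ln (real n))"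
    unfolding Let_def sample_budget_def[symmetric]
    by (intro conjI impI prob_sample_coreset expectation_card_sample_coreset) auto
qed simp_all

end
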